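(* Let $G$ be an $H$-type group with $m=\dim\mathfrak z$, and let $f\in L^1(G)$ be supported in $\mathfrak v\times K\subset G$ for some compact $K\subset\mathfrak z$. Let $Z$ be a zero set of $If$ of one of the following forms: 1. $m=1$ and $Z=\{\lambda\in\mathfrak z^*:|\lambda|\in[1,1+\varepsilon]\}$ for some $\varepsilon>0$; 2. $m>1$ and $Z\subset S(\mathfrak z^* )$ is compact, connected, and not contained in any affine hyperplane of $\mathfrak z^*$. Then $f=0$. In particular (for $m>1$), an arbitrarily small spherical cap of charges $C_h(\lambda_0)=\{\lambda\in S(\mathfrak z^* ):\lambda\cdot\lambda_0\ge1-h\}$, $\lambda_0\in S(\mathfrak z^* )$, $0<h\le1$, is an injectivity set for functions with compact central support: if $f\in L^1(G)$ is supported in $\mathfrak v\times K$ with $K$ compact and $C_h(\lambda_0)$ is a zero set of $If$, then $f=0$.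
   Context: $H$-type group: $\mathfrak g$ is a finite-dimensional real Lie algebra with $[\mathfrak g,[\mathfrak g,\mathfrak g]]=0$ and an inner product; $\mathfrak z\ne0$ is its center, $\mathfrak v\neq 0$ the orthogonal complement of $\mathfrak z$, $m=\dim\mathfrak z$. For $\mu\in\mathfrak z^*$ let $J_\mu:\mathfrak v\to\mathfrak v$ be the skew-adjoint map with $\langle J_\mu V,W\rangle=\mu([V,W])$; one requires $J_\mu^2=-|\mu|^2\mathrm{Id}$ for all $\mu$. $G$ is $\mathfrak v\times\mathfrak z$ with product $(x,u)(x',u')=(x+x',u+u'+\tfrac12[x,x'])$ and Haar measure $dx\,du$. The inner product identifies $\mathfrak v^*\cong\mathfrak v$, $\mathfrak z^*\cong\mathfrak z$; $S(\mathfrak v^* ),S(\mathfrak z^* )$ are the unit spheres; $\hat\lambda=\lambda/|\lambda|$. For $\nu\in S(\mathfrak v^* )$, $\lambda\in\mathfrak z^*\setminus\{0\}$: $\gamma_{\nu,\lambda}(s)=\big(e^{sJ_\lambda}J_\lambda^{-1}\nu,\tfrac{s}{2|\lambda|}\hat\lambda\big)$, $\Gamma_\lambda=\{(0,j\pi|\lambda|^{-2}\hat\lambda):j\in\mathbb Z\}$, $G_\lambda=G/\Gamma_\lambda$, and for $f\in L^1(G)$, $I_{\nu,\lambda}f(x,u)=\int_{\mathbb R}f((x,u)\gamma_{\nu,\lambda}(s))ds\in L^1(G_\lambda)$. A set $Z\subset\mathfrak z^*\setminus\{0\}$ is a zero set of $If$ if for every $\lambda\in Z$ there exists $\nu\in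 S(\mathfrak v^* )$ with $I_{\nu,\lambda}f=0$. *)

theory Defs
  imports "HOL-Analysis.Analysis"
begin

text \<open>
  A finite-dimensional real Lie algebra with inner product is written in coordinates adapted to
  the orthogonal splitting into the complement \<open>v\<close> of the centre and the centre \<open>z\<close>: it is the
  Euclidean space \<open>'v \<times> 'z\<close> with a bracket whose centre is exactly \<open>{0} \<times> 'z\<close>. The orthogonal
  complement of the centre is then \<open>'v \<times> {0}\<close>. Both summands are nonzero because every type of
  class \<open>euclidean_space\<close> has positive dimension, and \<open>dim z = DIM('z)\<close>. The dual of \<open>'z\<close> is
  identified with \<open>'z\<close> through the inner product, so a covector \<open>\<mu>\<close> acts as \<open>u \<mapsto> \<mu> \<bullet> u\<close>.
\<close>

definition lie_bracket :: "('a::real_vector \<Rightarrow> 'a \<Rightarrow> 'a) \<Rightarrow> bool" where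
  "lie_bracket br \<longleftrightarrow> bilinear br \<and> (\<forall>X. br X X = 0) \<and>
     (\<forall>X Y Z. br X (br Y Z) + br Y (br Z X) + br Z (br X Y) = 0)"

definition lie_center :: "('a::zero \<Rightarrow> 'a \<Rightarrow> 'a) \<Rightarrow> 'a set" where
  "lie_center br = {Z. \<forall>X. br Z X = 0}"

type_synonym ('v, 'z) bracket = "'v \<times> 'z \<Rightarrow> 'v \<times> 'z \<Rightarrow> 'v \<times> 'z"

definition hbr :: "('v::zero, 'z::zero) bracket \<Rightarrow> 'v \<Rightarrow> 'v \<Rightarrow> 'z" where
  "hbr br V W = snd (br (V, 0) (W, 0))"

definition Jmap :: "('v::euclidean_space, 'z::euclidean_space) bracket \<Rightarrow> 'z \<Rightarrow> 'v \<Rightarrow> 'v" where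
  "Jmap br \<mu> V = (THE U. \<forall>W. U \<bullet> W = \<mu> \<bullet> hbr br V W)"

definition H_type :: "('v::euclidean_space, 'z::euclidean_space) bracket \<Rightarrow> bool" where
  "H_type br \<longleftrightarrow> lie_bracket br \<and>
     (\<forall>X Y Z. br X (br Y Z) = 0) \<and>
     lie_center br = {0} \<times> UNIV \<and>
     (\<forall>\<mu> V. Jmap br \<mu> (Jmap br \<mu> V) = - ((norm \<mu>)\<^sup>2 *\<^sub>R V))"

text \<open>
  The group \<open>G\<close> has underlying set \<open>'v \<times> 'z\<close>, and its Haar measure \<open>dx du\<close> is \<open>lborel\<close>.
\<close>

definition gmult :: "('v::euclidean_space, 'z::euclidean_space) bracket \<Rightarrow>
    'v \<times> 'z \<Rightarrow> 'v \<times> 'z \<Rightarrow> 'v \<times> 'z" where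
  "gmult br g h = (fst g + fst h, snd g + snd h + (1/2) *\<^sub>R hbr br (fst g) (fst h))"

definition lin_exp :: "('a::real_normed_vector \<Rightarrow> 'a) \<Rightarrow> 'a \<Rightarrow> 'a" where
  "lin_exp A x = (\<Sum>n. (A ^^ n) x /\<^sub>R fact n)"

text \<open>Below, \<open>sgn lam = lam /\<^sub>R norm lam\<close> is the unit covector in the direction of \<open>lam\<close>.\<close>

definition gcurve :: "('v::euclidean_space, 'z::euclidean_space) bracket \<Rightarrow>
    'v \<Rightarrow> 'z \<Rightarrow> real \<Rightarrow> 'v \<times> 'z" where
  "gcurve br \<nu> lam s =
     (lin_exp (\<lambda>V. s *\<^sub>R Jmap br lam V) (inv (Jmap br lam) \<nu>), (s / (2 * norm lam)) *\<^sub>R sgn lam)"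

definition central_lattice :: "'z::euclidean_space \<Rightarrow> ('v::euclidean_space \<times> 'z) set" where
  "central_lattice lam = {(0, (of_int j * pi / (norm lam)\<^sup>2) *\<^sub>R sgn lam) | j. True}"

definition gcoset :: "('v::euclidean_space, 'z::euclidean_space) bracket \<Rightarrow>
    'z \<Rightarrow> 'v \<times> 'z \<Rightarrow> ('v \<times> 'z) set" where
  "gcoset br lam g = gmult br g ` central_lattice lam"

text \<open>
  The quotient \<open>G / \<Gamma>\<close> by \<open>\<Gamma> = central_lattice lam\<close>, as a measure space: its points are
  the cosets, it carries the quotient Borel structure, and its Haar measure is the image of the
  Haar measure restricted to the fundamental domain \<open>0 \<le> u \<bullet> sgn lam < pi / (norm lam)\<^sup>2\<close>.
\<close>

definition fund_domain :: "'z::euclidean_space \<Rightarrow> ('v::euclidean_space \<times> 'z) set" where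
  "fund_domain lam = {g. 0 \<le> snd g \<bullet> sgn lam \<and> snd g \<bullet> sgn lam < pi / (norm lam)\<^sup>2}"

definition quot :: "('v::euclidean_space, 'z::euclidean_space) bracket \<Rightarrow>
    'z \<Rightarrow> ('v \<times> 'z) set measure" where
  "quot br lam = distr (restrict_space lborel (fund_domain lam))
     (sigma (range (gcoset br lam))
        {A. A \<subseteq> range (gcoset br lam) \<and> gcoset br lam -` A \<in> sets borel})
     (gcoset br lam)"

text \<open>
  The value on a coset does not depend on the chosen representative, see \<open>xray_gcoset\<close> below.
\<close>

definition xray :: "('v::euclidean_space, 'z::euclidean_space) bracket \<Rightarrow>
    'v \<Rightarrow> 'z \<Rightarrow> ('v \<times> 'z \<Rightarrow> complex) \<Rightarrow> ('v \<times> 'z) set \<Rightarrow> complex" where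
  "xray br \<nu> lam f C = (LINT s|lborel. f (gmult br (SOME g. g \<in> C) (gcurve br \<nu> lam s)))"

text \<open>
  Vanishing of \<open>I f\<close> is meant in \<open>L\<^sup>1 (G / \<Gamma>)\<close>, hence almost everywhere. For integrable
  \<open>f\<close> the integrand is integrable on almost every coset, so the convention that the integral of a
  non-integrable function is 0 only matters on a null set.
\<close>

definition zero_set :: "('v::euclidean_space, 'z::euclidean_space) bracket \<Rightarrow>
    ('v \<times> 'z \<Rightarrow> complex) \<Rightarrow> 'z set \<Rightarrow> bool" where
  "zero_set br f Z \<longleftrightarrow> Z \<subseteq> - {0} \<and>
     (\<forall>lam\<in>Z. \<exists>\<nu>\<in>sphere 0 1. AE C in quot br lam. xray br \<nu> lam f C = 0)"

text \<open>Integrable functions are identified when equal almost everywhere, so supports are too.\<close>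

definition central_supp :: "('v::euclidean_space \<times> 'z::euclidean_space \<Rightarrow> complex) \<Rightarrow> 'z set \<Rightarrow> bool"
  where "central_supp f K \<longleftrightarrow> (AE g in lborel. g \<notin> UNIV \<times> K \<longrightarrow> f g = 0)"

definition cap :: "'z::euclidean_space \<Rightarrow> real \<Rightarrow> 'z set" where
  "cap lam0 h = {lam \<in> sphere 0 1. lam \<bullet> lam0 \<ge> 1 - h}"

lemma sets_quot:
  "sets (quot br lam) = {A. A \<subseteq> range (gcoset br lam) \<and> gcoset br lam -` A \<in> sets borel}"
proof -
  let ?q = "gcoset br lam"
  let ?S = "{A. A \<subseteq> range ?q \<and> ?q -` A \<in> sets borel}"
  have "sigma_algebra (range ?q) ?S"
    unfolding sigma_algebra_iff2
  proof (intro conjI ballI allI impI)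
    fix A assume "A \<in> ?S"
    moreover have "?q -` (range ?q - A) = UNIV - ?q -` A" by auto
    ultimately show "range ?q - A \<in> ?S" by (auto intro: sets.Diff)
  next
    fix A :: "nat \<Rightarrow> _" assume "range A \<subseteq> ?S"
    then have "(\<Union>i. ?q -` A i) \<in> sets borel" by (intro sets.countable_UN) auto
    with \<open>range A \<subseteq> ?S\<close> show "\<Union> (range A) \<in> ?S" by (auto simp: vimage_UN)
  qed auto
  then show ?thesis
    unfolding quot_def by (simp add: sigma_algebra.sigma_sets_eq Collect_mono subset_eq)
qed

lemma emeasure_quot:
  assumes "A \<in> sets (quot br lam)"
  shows "emeasure (quot br lam) A = emeasure lborel (gcoset br lam -` A \<inter> fund_domain lam)"
proof -
  let ?q = "gcoset br lam" and ?D = "fund_domain lam :: ('a \<times> 'b) set"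
  let ?S = "{A. A \<subseteq> range ?q \<and> ?q -` A \<in> sets borel}"
  have D: "?D \<in> sets borel"
  proof -
    have c: "continuous_on UNIV (\<lambda>g :: 'a \<times> 'b. snd g \<bullet> sgn lam)"
      by (intro continuous_intros)
    have "?D = {g. 0 \<le> snd g \<bullet> sgn lam} \<inter> {g. snd g \<bullet> sgn lam < pi / (norm lam)\<^sup>2}"
      by (auto simp: fund_domain_def)
    then show ?thesis
      using closed_Collect_le[OF continuous_on_const c] open_Collect_less[OF c continuous_on_const]
      by (simp add: borel_closed borel_open sets.Int)
  qed
  have "?q \<in> measurable (restrict_space lborel ?D) (sigma (range ?q) ?S)"
    by (rule measurable_measure_of)
      (auto simp: space_restrict_space sets_restrict_space intro: sets.Int D)
  then have "emeasure (quot br lam) A =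
      emeasure (restrict_space lborel ?D) (?q -` A \<inter> space (restrict_space lborel ?D))"
    using assms unfolding quot_def by (intro emeasure_distr) simp_all
  also have "\<dots> = emeasure lborel (?q -` A \<inter> ?D)"
    using D by (simp add: space_restrict_space emeasure_restrict_space)
  finally show ?thesis .
qed

lemma bilinear_hbr:
  assumes "bilinear br" shows "bilinear (hbr br)"
proof -
  have "linear (\<lambda>V. (V, 0))"
    by (rule linearI) auto
  note l = this linear_snd
  from assms have a: "\<And>X. linear (br X)" "\<And>Y. linear (\<lambda>X. br X Y)"
    by (auto simp: bilinear_def)
  show ?thesis
    unfolding bilinear_def hbr_def
    using linear_compose[OF linear_compose[OF l(1) a(1)] l(2)]
      linear_compose[OF linear_compose[OF l(1) a(2)] l(2)]
    by (auto simp: o_def)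
qed

lemma Jmap_inner:
  assumes "H_type br" shows "Jmap br \<mu> V \<bullet> W = \<mu> \<bullet> hbr br V W"
proof -
  have b: "bilinear (hbr br)"
    using assms by (auto simp: H_type_def lie_bracket_def intro: bilinear_hbr)
  let ?U = "adjoint (hbr br V) \<mu>"
  have U: "\<forall>W. ?U \<bullet> W = \<mu> \<bullet> hbr br V W"
    using b adjoint_works[of "hbr br V" _ \<mu>] by (auto simp: bilinear_def inner_commute)
  have "Jmap br \<mu> V = ?U"
    unfolding Jmap_def
  proof (rule the_equality)
    fix U assume "\<forall>W. U \<bullet> W = \<mu> \<bullet> hbr br V W"
    with U have "\<forall>W. U \<bullet> W = ?U \<bullet> W" by simp
    then show "U = ?U" by (simp only: vector_eq_rdot)
  qed (rule U)
  with U show ?thesis by (simp only:)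
qed

lemma linear_Jmap:
  assumes "H_type br" shows "linear (Jmap br \<mu>)"
proof -
  have b: "bilinear (hbr br)"
    using assms by (auto simp: H_type_def lie_bracket_def intro: bilinear_hbr)
  show ?thesis
  proof (rule linearI)
    fix x y show "Jmap br \<mu> (x + y) = Jmap br \<mu> x + Jmap br \<mu> y"
      by (rule vector_eq_rdot[THEN iffD1])
        (simp add: inner_add_left Jmap_inner[OF assms] bilinear_ladd[OF b] inner_add_right)
  next
    fix c x show "Jmap br \<mu> (c *\<^sub>R x) = c *\<^sub>R Jmap br \<mu> x"
      by (rule vector_eq_rdot[THEN iffD1])
        (simp add: Jmap_inner[OF assms] bilinear_lmul[OF b])
  qed
qed

lemma lin_exp_Jmap:
  assumes "H_type br" and "lam \<noteq> 0"
  shows "lin_exp (\<lambda>V. s *\<^sub>R Jmap br lam V) x =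
     cos (s * norm lam) *\<^sub>R x + (sin (s * norm lam) / norm lam) *\<^sub>R Jmap br lam x"
proof -
  let ?r = "norm lam" and ?A = "\<lambda>V. s *\<^sub>R Jmap br lam V"
  have r: "?r > 0" using assms by auto
  have J2: "Jmap br lam (Jmap br lam V) = - (?r\<^sup>2 *\<^sub>R V)" for V
    using assms by (auto simp: H_type_def)
  have pow: "(?A ^^ n) x /\<^sub>R fact n = (cos_coeff n * (s * ?r) ^ n) *\<^sub>R x +
      (sin_coeff n * (s * ?r) ^ n) *\<^sub>R (Jmap br lam x /\<^sub>R ?r)" for n
  proof (induction n)
    case 0 show ?case by (simp add: cos_coeff_def sin_coeff_def)
  next
    case (Suc n)
    have "(?A ^^ Suc n) x /\<^sub>R fact (Suc n) = (s / Suc n) *\<^sub>R Jmap br lam ((?A ^^ n) x /\<^sub>R fact n)"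
      using linear_Jmap[OF assms(1)] by (simp add: linear_scale divide_simps)
    also have "\<dots> = (s / Suc n) *\<^sub>R ((cos_coeff n * (s * ?r) ^ n) *\<^sub>R Jmap br lam x -
        (sin_coeff n * (s * ?r) ^ n) *\<^sub>R (?r *\<^sub>R x))"
      unfolding Suc using r linear_Jmap[OF assms(1)]
      by (simp add: linear_add linear_scale J2 power2_eq_square)
    finally show ?case
      using r by (simp add: cos_coeff_Suc sin_coeff_Suc algebra_simps divide_simps)
  qed
  have c: "(\<lambda>n. cos_coeff n * (s * ?r) ^ n) sums cos (s * ?r)"
    using cos_converges[of "s * ?r"] by simp
  have d: "(\<lambda>n. sin_coeff n * (s * ?r) ^ n) sums sin (s * ?r)"
    using sin_converges[of "s * ?r"] by simp
  have "(\<lambda>n. (?A ^^ n) x /\<^sub>R fact n) sums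
      (cos (s * ?r) *\<^sub>R x + sin (s * ?r) *\<^sub>R (Jmap br lam x /\<^sub>R ?r))"
    unfolding pow using c d
    by (intro sums_add bounded_linear.sums[OF bounded_linear_scaleR_left])
  then show ?thesis
    unfolding lin_exp_def by (simp add: sums_unique[symmetric] divide_inverse)
qed

lemma xray_gcoset:
  assumes "H_type br" and "lam \<noteq> 0"
  shows "xray br \<nu> lam f (gcoset br lam g) = (LINT s|lborel. f (gmult br g (gcurve br \<nu> lam s)))"
proof -
  let ?r = "norm lam"
  have r: "?r > 0" using assms by auto
  have b: "bilinear (hbr br)"
    using assms by (auto simp: H_type_def lie_bracket_def intro: bilinear_hbr)
  define h where "h = (SOME h. h \<in> gcoset br lam g)"
  have "(0, 0) \<in> central_lattice lam" unfolding central_lattice_def by (auto intro: exI[of _ 0])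
  then have "gmult br g (0, 0) \<in> gcoset br lam g"
    unfolding gcoset_def by (rule imageI)
  then have "h \<in> gcoset br lam g"
    unfolding h_def by (rule someI)
  then obtain j :: int where h: "h = gmult br g (0, (of_int j * pi / ?r\<^sup>2) *\<^sub>R sgn lam)"
    unfolding gcoset_def central_lattice_def by auto
  define t where "t = 2 * pi * of_int j / ?r"
  have tr: "(s + t) * ?r = s * ?r + 2 * pi * of_int j" for s
    using r by (simp add: t_def field_simps)
  have per: "cos ((s + t) * ?r) = cos (s * ?r)" "sin ((s + t) * ?r) = sin (s * ?r)" for s
    unfolding tr using sin_cos_eq_iff[of "s * ?r + 2 * pi * of_int j" "s * ?r"]
    by (auto intro!: exI[of _ j])
  have sc: "(t + s) / (2 * ?r) = of_int j * pi / ?r\<^sup>2 + s / (2 * ?r)" for s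
    using r by (simp add: t_def power2_eq_square add_divide_distrib)
  have "gcurve br \<nu> lam (t + s) = gcurve br \<nu> lam s + (0, (of_int j * pi / ?r\<^sup>2) *\<^sub>R sgn lam)" for s
    unfolding gcurve_def lin_exp_Jmap[OF assms] sc
    using per[of s] by (simp add: add.commute[of t] scaleR_add_left)
  then have "gmult br h (gcurve br \<nu> lam s) = gmult br g (gcurve br \<nu> lam (t + s))" for s
    unfolding h gmult_def by (simp add: bilinear_rzero[OF b])
  then show ?thesis
    unfolding xray_def h_def[symmetric]
    using lborel_integral_real_affine[of 1 "\<lambda>s. f (gmult br g (gcurve br \<nu> lam s))" t] by simp
qed

end

theory Submission
  imports Defs "HOL-Complex_Analysis.Cauchy_Integral_Formula"
begin

text \<open>
  Let \<open>F \<mu>\<close> be the partial Fourier transform of \<open>f\<close> in the central variable. As \<open>f\<close> has compact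
  central support, \<open>F \<mu> x\<close> is analytic in \<open>\<mu>\<close>, so it suffices that \<open>F \<mu> = 0\<close> for all \<open>\<mu>\<close> in a
  nonempty open set. Testing the X-ray transform against characters \<open>\<mu>\<close> that are trivial on the
  central lattice of \<open>lam\<close>, that is \<open>\<mu> \<bullet> sgn lam = 2 k |lam|\<^sup>2\<close> with \<open>k\<close> an integer, shows that
  a twisted average of \<open>F \<mu>\<close> over circles of radius \<open>1 / |lam|\<close> vanishes.

  In the case \<open>m > 1\<close> take \<open>k = 0\<close> and \<open>\<mu>\<close> orthogonal to \<open>lam\<close>: after a unimodular change of \<open>F \<mu>\<close>
  the twist disappears, and the Fourier transform of the circle does not vanish on any open set.
  If \<open>l1\<close> and \<open>l2\<close> are two points of the connected set \<open>Z\<close>, every \<open>\<mu>\<close> in the open set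
  \<open>\<mu> \<bullet> l2 < 0 < \<mu> \<bullet> l1\<close> is orthogonal to some \<open>lam\<close> in \<open>Z\<close>.

  In the case \<open>m = 1\<close> take \<open>k = 1\<close> and \<open>\<mu> = 2 |lam| lam\<close>, which fills an open set as \<open>|lam|\<close> ranges over
  an interval. Pairing with Gaussians times polynomials gives recursions for the moments of
  \<open>F \<mu>\<close> times a Gaussian, whose leading coefficients are values at 1 of Laguerre polynomials
  and do not vanish. Hence all these moments are zero.
\<close>

section \<open>Uniqueness for Fourier transforms\<close>

lemma integrable_mult_bounded:
  fixes h q :: "'a \<Rightarrow> complex"
  assumes "integrable M h" and [measurable]: "q \<in> borel_measurable M" and "\<And>y. norm (q y) \<le> B"
  shows "integrable M (\<lambda>y. h y * q y)"
proof (rule Bochner_Integration.integrable_bound)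
  show "integrable M (\<lambda>y. B * norm (h y))" using assms(1) by auto
  have [measurable]: "h \<in> borel_measurable M" using assms(1) by auto
  show "(\<lambda>y. h y * q y) \<in> borel_measurable M" by measurable
  have "norm (h y * q y) \<le> B * norm (h y)" for y
    using mult_right_mono[OF assms(3)[of y] norm_ge_zero[of "h y"]]
    by (simp add: norm_mult mult.commute)
  then show "AE y in M. norm (h y * q y) \<le> norm (B * norm (h y))"
    by (intro AE_I2) (metis abs_ge_self norm_conv_dist order_trans real_norm_def)
qed

lemma borel_measurable_cis_inner [measurable]:
  "(\<lambda>y. cis (\<xi> \<bullet> y)) \<in> borel_measurable borel"
  by (intro borel_measurable_continuous_onI continuous_intros)

lemma real_polynomial_function_measurable:
  "real_polynomial_function p \<Longrightarrow> p \<in> borel_measurable borel"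
  by (intro borel_measurable_continuous_onI continuous_on_polymonial_function)
    (simp add: real_polynomial_function_eq)

text \<open>
  Composing with \<open>y \<mapsto> R sin (y / R)\<close> turns polynomials into trigonometric polynomials, which an
  integrable function with vanishing Fourier transform annihilates; as \<open>R\<close> grows, the
  composition converges to the identity.
\<close>

lemma fourier_zero_poly_sin:
  fixes h :: "'a::euclidean_space \<Rightarrow> complex"
  assumes h: "integrable lborel h"
    and F: "\<And>\<xi>. (LINT y|lborel. h y * cis (\<xi> \<bullet> y)) = 0"
    and p: "real_polynomial_function p"
  shows "(LINT y|lborel. h y * of_real (p (\<Sum>b\<in>Basis. (R * sin ((b /\<^sub>R R) \<bullet> y)) *\<^sub>R b))) = 0"
proof -
  define E :: "'a \<Rightarrow> 'a" where "E y = (\<Sum>b\<in>Basis. (R * sin ((b /\<^sub>R R) \<bullet> y)) *\<^sub>R b)" for y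
  \<comment> \<open>\<open>N\<close> consists of the bounded multipliers \<open>q\<close> for which
    \<open>h * q\<close> still has vanishing Fourier transform. Asking this at every frequency, not
    only for the integral of \<open>h * q\<close>, makes \<open>N\<close> stable under
    multiplication by characters and hence by sines.\<close>
  define N where "N = {q :: 'a \<Rightarrow> complex. q \<in> borel_measurable borel \<and>
    (\<exists>B. \<forall>y. norm (q y) \<le> B) \<and> (\<forall>\<xi>. (LINT y|lborel. h y * (q y * cis (\<xi> \<bullet> y))) = 0)}"
  have int: "integrable lborel (\<lambda>y. h y * (q y * cis (\<xi> \<bullet> y)))" if "q \<in> N" for q \<xi>
  proof -
    from that have [measurable]: "q \<in> borel_measurable borel" by (auto simp: N_def)
    from that obtain B where "\<And>y. norm (q y) \<le> B" by (auto simp: N_def)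
    then show ?thesis by (intro integrable_mult_bounded[OF h, where B = B]) (auto simp: norm_mult)
  qed
  have add: "(\<lambda>y. q y + q' y) \<in> N" if "q \<in> N" "q' \<in> N" for q q'
  proof -
    from that obtain B B' where "\<And>y. norm (q y) \<le> B" "\<And>y. norm (q' y) \<le> B'" by (auto simp: N_def)
    then have "norm (q y + q' y) \<le> B + B'" for y
      using norm_triangle_mono by blast
    moreover have "(LINT y|lborel. h y * ((q y + q' y) * cis (\<xi> \<bullet> y))) = 0" for \<xi>
      using that Bochner_Integration.integral_add[OF int[OF that(1), of \<xi>] int[OF that(2), of \<xi>]]
      by (auto simp: N_def algebra_simps)
    ultimately show ?thesis using that by (auto simp: N_def)
  qed
  have scaleN: "(\<lambda>y. c * q y) \<in> N" if "q \<in> N" for q and c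
  proof -
    from that obtain B where "\<And>y. norm (q y) \<le> B" by (auto simp: N_def)
    then have "norm (c * q y) \<le> norm c * B" for y
      by (simp add: norm_mult mult_left_mono)
    moreover have "(LINT y|lborel. h y * ((c * q y) * cis (\<xi> \<bullet> y))) = 0" for \<xi>
      using that integral_mult_right_zero[of lborel c "\<lambda>y. h y * (q y * cis (\<xi> \<bullet> y))"]
      by (auto simp: N_def mult_ac)
    ultimately show ?thesis using that by (auto simp: N_def)
  qed
  have cis: "(\<lambda>y. cis (\<eta> \<bullet> y) * q y) \<in> N" if "q \<in> N" for q \<eta>
  proof -
    from that obtain B where "\<And>y. norm (q y) \<le> B" by (auto simp: N_def)
    then have "norm (cis (\<eta> \<bullet> y) * q y) \<le> B" for y by (simp add: norm_mult)
    moreover have "(LINT y|lborel. h y * ((cis (\<eta> \<bullet> y) * q y) * cis (\<xi> \<bullet> y))) = 0" for \<xi>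
    proof -
      have "(cis (\<eta> \<bullet> y) * q y) * cis (\<xi> \<bullet> y) = q y * cis ((\<eta> + \<xi>) \<bullet> y)" for y
        by (simp add: cis_mult[symmetric] inner_add_left mult_ac)
      then have "(\<lambda>y. h y * ((cis (\<eta> \<bullet> y) * q y) * cis (\<xi> \<bullet> y))) = (\<lambda>y. h y * (q y * cis ((\<eta> + \<xi>) \<bullet> y)))"
        by (rule_tac ext) (simp only:)
      then show ?thesis using that by (simp add: N_def)
    qed
    ultimately show ?thesis using that by (auto simp: N_def)
  qed
  have sin: "(\<lambda>y. of_real (sin (\<eta> \<bullet> y)) * q y) \<in> N" if "q \<in> N" for q \<eta>
  proof -
    have "of_real (sin (\<eta> \<bullet> y)) * q y =
        (- \<i> / 2) * (cis (\<eta> \<bullet> y) * q y) + (\<i> / 2) * (cis ((- \<eta>) \<bullet> y) * q y)" for y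
      by (auto simp: complex_eq_iff field_simps)
    moreover have "(\<lambda>y. (- \<i> / 2) * (cis (\<eta> \<bullet> y) * q y) + (\<i> / 2) * (cis ((- \<eta>) \<bullet> y) * q y)) \<in> N"
      by (intro add scaleN cis that)
    ultimately show ?thesis by (simp only:)
  qed
  have sumN: "(\<lambda>y. \<Sum>b\<in>S. g b y) \<in> N" if "finite S" "\<And>b. b \<in> S \<Longrightarrow> g b \<in> N"
    for S :: "'a set" and g
    using that
  proof (induction S)
    case empty
    have "(\<lambda>y. 0) \<in> N" by (auto simp: N_def)
    then show ?case by simp
  next
    case (insert b S)
    then show ?case using add[of "g b" "\<lambda>y. \<Sum>b\<in>S. g b y"] by simp
  qed
  \<comment> \<open>With an arbitrary \<open>q\<close> in the claim, the case of a product applies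
    the two induction hypotheses one after the other; the case of a linear map reduces to the
    closure under sines.\<close>
  have "(\<lambda>y. of_real (p (E y)) * q y) \<in> N" if "q \<in> N" for q
    using p that
  proof (induction arbitrary: q)
    case (linear f q)
    interpret bounded_linear f by fact
    have "of_real (f (E y)) * q y =
        (\<Sum>b\<in>Basis. of_real (R * f b) * (of_real (sin ((b /\<^sub>R R) \<bullet> y)) * q y))" for y
      by (simp add: E_def sum scaleR sum_distrib_left mult_ac del: inner_scaleR_left)
    then show ?case
      by (simp only:) (intro sumN scaleN sin linear.prems finite_Basis)
  next
    case (const c)
    then show ?case by (rule scaleN)
  next
    case (add f g)
    then show ?case
      using \<open>\<And>q q'. q \<in> N \<Longrightarrow> q' \<in> N \<Longrightarrow> _\<close>[OF add.IH(1)[OF add.prems] add.IH(2)[OF add.prems]]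
      by (simp add: distrib_right)
  next
    case (mult f g)
    then show ?case
      using mult.IH(1)[OF mult.IH(2)[OF mult.prems]] by (simp add: mult.assoc)
  qed
  moreover have "(\<lambda>y. 1) \<in> N" using F by (auto simp: N_def intro: exI[of _ 1])
  ultimately have "(\<lambda>y. of_real (p (E y)) * 1) \<in> N" by blast
  then have "(LINT y|lborel. h y * (of_real (p (E y)) * 1 * cis (0 \<bullet> y))) = 0"
    unfolding N_def by blast
  then show ?thesis by (simp add: E_def)
qed

text \<open>The sine map takes values in a fixed ball. There Stone-Weierstrass approximates
  \<open>g\<close> uniformly by polynomials, and an error \<open>e\<close> in \<open>g\<close> costs
  at most \<open>e\<close> times the L1 norm of \<open>h\<close>.\<close>

lemma fourier_zero_continuous_sin:
  fixes h :: "'a::euclidean_space \<Rightarrow> complex"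
  assumes h: "integrable lborel h"
    and F: "\<And>\<xi>. (LINT y|lborel. h y * cis (\<xi> \<bullet> y)) = 0"
    and g: "continuous_on UNIV (g :: 'a \<Rightarrow> real)"
  shows "(LINT y|lborel. h y * of_real (g (\<Sum>b\<in>Basis. (R * sin ((b /\<^sub>R R) \<bullet> y)) *\<^sub>R b))) = 0"
proof -
  define E :: "'a \<Rightarrow> 'a" where "E y = (\<Sum>b\<in>Basis. (R * sin ((b /\<^sub>R R) \<bullet> y)) *\<^sub>R b)" for y
  have cE: "continuous_on UNIV E" unfolding E_def by (intro continuous_intros)
  then have [measurable]: "E \<in> borel_measurable borel" by (rule borel_measurable_continuous_onI)
  have [measurable]: "g \<in> borel_measurable borel" using g by (rule borel_measurable_continuous_onI)
  define C where "C = cball (0::'a) (DIM('a) * \<bar>R\<bar>)"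
  have EC: "E y \<in> C" for y
  proof -
    have "norm (E y) \<le> (\<Sum>b\<in>(Basis::'a set). \<bar>R\<bar>)"
      unfolding E_def
    proof (rule order_trans[OF norm_sum], rule sum_mono)
      fix b :: 'a assume "b \<in> Basis"
      then show "norm ((R * sin ((b /\<^sub>R R) \<bullet> y)) *\<^sub>R b) \<le> \<bar>R\<bar>"
        using mult_left_mono[OF abs_sin_le_one abs_ge_zero[of R], of "(b /\<^sub>R R) \<bullet> y"]
        by (simp add: abs_mult)
    qed
    then show ?thesis by (simp add: C_def)
  qed
  have "compact C" by (simp add: C_def)
  have "compact (g ` C)" using \<open>compact C\<close> g by (blast intro: compact_continuous_image continuous_on_subset)
  then obtain B where "\<And>x. x \<in> C \<Longrightarrow> norm (g x) \<le> B"
    using compact_imp_bounded[of "g ` C"] by (auto simp: bounded_iff)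
  then have ig: "integrable lborel (\<lambda>y. h y * of_real (g (E y)))"
    using EC by (intro integrable_mult_bounded[OF h, where B = B]) auto
  have "norm (LINT y|lborel. h y * of_real (g (E y))) \<le> e * (LINT y|lborel. norm (h y))"
    if "e > 0" for e
  proof -
    obtain p where p: "real_polynomial_function p" "\<And>x. x \<in> C \<Longrightarrow> \<bar>g x - p x\<bar> < e"
      using Stone_Weierstrass_real_polynomial_function[OF \<open>compact C\<close> _ \<open>e > 0\<close>, of g] g
      by (auto intro: continuous_on_subset)
    have [measurable]: "p \<in> borel_measurable borel" using p(1) by (rule real_polynomial_function_measurable)
    have id: "integrable lborel (\<lambda>y. h y * of_real (g (E y) - p (E y)))"
      using EC p(2) less_imp_le
      by (intro integrable_mult_bounded[OF h, where B = e]) (auto simp del: of_real_diff)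
    have "integrable lborel (\<lambda>y. h y * of_real (p (E y)))"
      using Bochner_Integration.integrable_diff[OF ig id] by (simp add: algebra_simps)
    then have "(LINT y|lborel. h y * of_real (g (E y))) =
        (LINT y|lborel. h y * of_real (g (E y) - p (E y)))"
      using fourier_zero_poly_sin[OF h F p(1), of R] Bochner_Integration.integral_diff[OF ig, of "\<lambda>y. h y * of_real (p (E y))"]
      unfolding E_def[symmetric] by (simp add: algebra_simps)
    also have "norm \<dots> \<le> (LINT y|lborel. norm (h y * of_real (g (E y) - p (E y))))"
      by (rule integral_norm_bound)
    also have "\<dots> \<le> (LINT y|lborel. e * norm (h y))"
      using integrable_norm[OF id] h less_imp_le[OF p(2)[OF EC]]
      by (intro integral_mono) (simp_all add: norm_mult mult.commute[of e] mult_left_mono del: of_real_diff)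
    finally show ?thesis by simp
  qed
  note b = this
  have "norm (LINT y|lborel. h y * of_real (g (E y))) \<le> 0"
  proof (rule tendsto_lowerbound)
    show "((\<lambda>e. e * (LINT y|lborel. norm (h y))) \<longlongrightarrow> 0) (at_right 0)"
      by (auto intro!: tendsto_eq_intros)
    show "\<forall>\<^sub>F e in at_right 0. norm (LINT y|lborel. h y * of_real (g (E y))) \<le> e * (LINT y|lborel. norm (h y))"
      using b by (auto simp: eventually_at_right_less intro: eventually_mono[OF eventually_at_right_less])
  qed auto
  then show ?thesis by (simp add: E_def)
qed

lemma tendsto_mult_sin_divide: "(\<lambda>n. real (Suc n) * sin (x / real (Suc n))) \<longlonglongrightarrow> x"
proof (cases "x = 0")
  case False
  have "((\<lambda>t. sin t / t) \<longlongrightarrow> 1) (at (0::real))"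
    using DERIV_sin[of 0] by (simp add: has_field_derivative_iff)
  moreover have "filterlim (\<lambda>n. x / real (Suc n)) (at 0) sequentially"
    using False LIMSEQ_Suc[OF lim_const_over_n[of x]] by (auto simp: filterlim_at)
  ultimately have "(\<lambda>n. x * (sin (x / real (Suc n)) / (x / real (Suc n)))) \<longlonglongrightarrow> x * 1"
    by (intro tendsto_mult tendsto_const) (rule filterlim_compose)
  then show ?thesis using False by (simp add: mult.commute)
qed simp

text \<open>Dominated convergence along \<open>R = Suc n\<close>; the bound on \<open>g\<close>
  supplies the dominating function \<open>B * norm (h y)\<close>.\<close>

lemma fourier_zero_bounded_continuous:
  fixes h :: "'a::euclidean_space \<Rightarrow> complex"
  assumes h: "integrable lborel h"
    and F: "\<And>\<xi>. (LINT y|lborel. h y * cis (\<xi> \<bullet> y)) = 0"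
    and g: "continuous_on UNIV (g :: 'a \<Rightarrow> real)" and B: "\<And>y. \<bar>g y\<bar> \<le> B"
  shows "(LINT y|lborel. h y * of_real (g y)) = 0"
proof -
  define E :: "nat \<Rightarrow> 'a \<Rightarrow> 'a" where
    "E n y = (\<Sum>b\<in>Basis. (real (Suc n) * sin ((b /\<^sub>R real (Suc n)) \<bullet> y)) *\<^sub>R b)" for n y
  have cE: "continuous_on UNIV (E n)" for n unfolding E_def by (intro continuous_intros)
  then have [measurable]: "E n \<in> borel_measurable borel" for n by (rule borel_measurable_continuous_onI)
  have [measurable]: "g \<in> borel_measurable borel" using g by (rule borel_measurable_continuous_onI)
  have [measurable]: "h \<in> borel_measurable borel" using h by auto
  have lim: "(\<lambda>n. E n y) \<longlonglongrightarrow> y" for y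
  proof -
    have "(\<lambda>n. E n y) \<longlonglongrightarrow> (\<Sum>b\<in>Basis. (b \<bullet> y) *\<^sub>R b)"
      unfolding E_def using tendsto_mult_sin_divide
      by (intro tendsto_intros) (simp add: divide_inverse mult.commute)
    then show ?thesis by (simp add: inner_commute[of _ y] euclidean_representation)
  qed
  have "(\<lambda>n. LINT y|lborel. h y * of_real (g (E n y))) \<longlonglongrightarrow> (LINT y|lborel. h y * of_real (g y))"
  proof (rule integral_dominated_convergence[where w = "\<lambda>y. B * norm (h y)"])
    show "AE y in lborel. (\<lambda>n. h y * of_real (g (E n y))) \<longlonglongrightarrow> h y * of_real (g y)"
    proof (rule AE_I2)
      fix y
      have "isCont g y" using g by (simp add: continuous_on_eq_continuous_at)
      then show "(\<lambda>n. h y * of_real (g (E n y))) \<longlonglongrightarrow> h y * of_real (g y)"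
        by (intro tendsto_intros isCont_tendsto_compose[OF _ lim])
    qed
    show "AE y in lborel. norm (h y * of_real (g (E n y))) \<le> B * norm (h y)" for n
      using B by (auto simp: norm_mult mult.commute[of B] intro!: mult_left_mono)
  qed (use h in auto)
  moreover have "(LINT y|lborel. h y * of_real (g (E n y))) = 0" for n
    unfolding E_def by (rule fourier_zero_continuous_sin[OF h F g])
  ultimately show ?thesis by (simp add: LIMSEQ_const_iff)
qed

text \<open>Bounded continuous functions approximate indicators of closed sets. Closed sets are an
  intersection-stable generator of the Borel sets, so a Dynkin argument shows that \<open>h\<close>
  has integral zero over every Borel set.\<close>

theorem fourier_unique:
  fixes h :: "'a::euclidean_space \<Rightarrow> complex"
  assumes h: "integrable lborel h"
    and F: "\<And>\<xi>. (LINT y|lborel. h y * cis (\<xi> \<bullet> y)) = 0"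
  shows "AE y in lborel. h y = 0"
proof (rule sigma_finite_measure.density_zero[OF sigma_finite_lborel h])
  have [measurable]: "h \<in> borel_measurable borel" using h by auto
  have cl: "(LINT y|lborel. indicator C y *\<^sub>R h y) = 0" if "closed C" for C
  proof (cases "C = {}")
    case False
    \<comment> \<open>These continuous functions decrease to the indicator of \<open>C\<close>: off
      the closed set the distance is positive, so they are eventually zero at each point.\<close>
    define g where "g n y = max 0 (1 - real n * infdist y C)" for n :: nat and y
    have cg: "continuous_on UNIV (g n)" for n unfolding g_def by (intro continuous_intros)
    have bg: "\<bar>g n y\<bar> \<le> 1" for n y by (auto simp: g_def infdist_nonneg)
    have [measurable]: "g n \<in> borel_measurable borel" for n
      using cg by (rule borel_measurable_continuous_onI)
    have [measurable]: "C \<in> sets borel" using that by auto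
    have "(\<lambda>n. LINT y|lborel. h y * of_real (g n y)) \<longlonglongrightarrow> (LINT y|lborel. indicator C y *\<^sub>R h y)"
    proof (rule integral_dominated_convergence[where w = "\<lambda>y. norm (h y)"])
      show "AE y in lborel. (\<lambda>n. h y * of_real (g n y)) \<longlonglongrightarrow> indicator C y *\<^sub>R h y"
      proof (rule AE_I2)
        fix y
        show "(\<lambda>n. h y * of_real (g n y)) \<longlonglongrightarrow> indicator C y *\<^sub>R h y"
        proof (cases "y \<in> C")
          case True then show ?thesis by (simp add: g_def)
        next
          case out: False
          then have d: "infdist y C > 0"
            using that False in_closed_iff_infdist_zero[of C y] infdist_nonneg[of y C] by force
          obtain n0 :: nat where n0: "1 / infdist y C < n0" using reals_Archimedean2 by blast
          have "g n y = 0" if "n \<ge> n0" for n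
          proof -
            have "1 / infdist y C < n" using n0 that by linarith
            then show ?thesis using d by (simp add: g_def field_simps)
          qed
          then have "\<forall>\<^sub>F n in sequentially. h y * of_real (g n y) = 0"
            by (auto simp: eventually_sequentially)
          then show ?thesis using out by (simp add: tendsto_eventually)
        qed
      qed
      show "AE y in lborel. norm (h y * of_real (g n y)) \<le> norm (h y)" for n
        using bg[of n] by (auto simp: norm_mult intro!: mult_left_le)
    qed (use h in auto)
    moreover have "(LINT y|lborel. h y * of_real (g n y)) = 0" for n
      by (rule fourier_zero_bounded_continuous[OF h F cg bg])
    ultimately show ?thesis by (simp add: LIMSEQ_const_iff)
  qed simp
  have ii: "integrable lborel (\<lambda>y. indicator A y *\<^sub>R h y)" if "A \<in> sets borel" for A
    using that h by (intro integrable_mult_indicator) auto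
  fix A :: "'a set" assume "A \<in> sets lborel"
  then have A: "A \<in> sigma_sets UNIV (Collect closed)"
    using sets_measure_of[of "Collect closed" "UNIV :: 'a set"] by (simp add: borel_eq_closed)
  have "Int_stable (Collect closed :: 'a set set)" "Collect closed \<subseteq> Pow (UNIV :: 'a set)"
    by (auto simp: Int_stable_def)
  from this A have "(LINT y|lborel. indicator A y *\<^sub>R h y) = 0"
  proof (induction rule: sigma_sets_induct_disjoint)
    case (compl A)
    then have A: "A \<in> sets borel"
      using sets_measure_of[of "Collect closed" "UNIV :: 'a set"] by (simp add: borel_eq_closed)
    have "(LINT y|lborel. h y) = 0" using F[of 0] by simp
    moreover have "indicator (UNIV - A) y *\<^sub>R h y = h y - indicator A y *\<^sub>R h y" for y
      by (auto simp: indicator_def)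
    ultimately show ?case using compl ii[OF A] h by simp
  next
    case (union A)
    then have A: "A i \<in> sets borel" for i
      using sets_measure_of[of "Collect closed" "UNIV :: 'a set"] by (auto simp: borel_eq_closed)
    have "set_integrable lborel (\<Union>i. A i) h"
      unfolding set_integrable_def by (rule ii) (use A in auto)
    then have "(LINT y:(\<Union>i. A i)|lborel. h y) = (\<Sum>i. (LINT y:(A i)|lborel. h y))"
      using A union(1) by (intro lebesgue_integral_countable_add) (auto simp: disjoint_family_on_def)
    then show ?case using union(3) by (simp add: set_lebesgue_integral_def)
  qed (use cl in auto)
  then show "(LINT y:A|lborel. h y) = 0" by (simp add: set_lebesgue_integral_def)
qed

section \<open>Entire functions given by exponential integrals, and the identity theorem\<close>

text \<open>Exponential integrability lets the exponential series be integrated term by term. The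
  integral thus becomes an entire function of \<open>z\<close> whose Taylor coefficients are the
  moments of \<open>h\<close> up to nonzero factors.\<close>

lemma cis_integral_sums:
  fixes h :: "'a \<Rightarrow> complex" and q :: "'a \<Rightarrow> real"
  assumes [measurable]: "h \<in> borel_measurable M" "q \<in> borel_measurable M"
    and int: "\<And>c. integrable M (\<lambda>y. exp (c * \<bar>q y\<bar>) * norm (h y))"
  shows "(\<lambda>n. (LINT y|M. h y * of_real (q y) ^ n) * ((- \<i>) ^ n / fact n) * z ^ n) sums
     (LINT y|M. h y * exp (- \<i> * z * of_real (q y)))"
proof -
  define f where "f n y = h y * ((- \<i> * z * of_real (q y)) ^ n /\<^sub>R fact n)" for n y
  have [measurable]: "f n \<in> borel_measurable M" for n unfolding f_def by measurable
  have nf: "norm (f n y) = norm (h y) * ((norm z * \<bar>q y\<bar>) ^ n /\<^sub>R fact n)" for n y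
    by (simp add: f_def norm_mult norm_power power_mult_distrib divide_inverse)
  have s: "(\<lambda>n. norm (f n y)) sums (norm (h y) * exp (norm z * \<bar>q y\<bar>))" for y
    unfolding nf by (intro sums_mult exp_converges)
  have s': "(\<lambda>n. f n y) sums (h y * exp (- \<i> * z * of_real (q y)))" for y
    unfolding f_def by (intro sums_mult exp_converges)
  have le: "norm (f n y) \<le> norm (h y) * exp (norm z * \<bar>q y\<bar>)" for n y
    using sum_le_suminf[of "\<lambda>n. norm (f n y)" "{n}"] s[of y] by (auto simp: sums_iff)
  have if': "integrable M (f n)" for n
    by (rule Bochner_Integration.integrable_bound[OF int[of "norm z"]])
      (use le in \<open>auto simp: mult.commute\<close>)
  have "summable (\<lambda>n. LINT y|M. norm (f n y))"
  proof (rule bounded_imp_summable)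
    fix n
    have "(\<Sum>k\<le>n. LINT y|M. norm (f k y)) = (LINT y|M. (\<Sum>k\<le>n. norm (f k y)))"
      using if' by (subst Bochner_Integration.integral_sum) auto
    also have "\<dots> \<le> (LINT y|M. exp (norm z * \<bar>q y\<bar>) * norm (h y))"
    proof (rule integral_mono)
      show "(\<Sum>k\<le>n. norm (f k y)) \<le> exp (norm z * \<bar>q y\<bar>) * norm (h y)" for y
        using sum_le_suminf[of "\<lambda>n. norm (f n y)" "{..n}"] s[of y] by (auto simp: sums_iff mult.commute)
    qed (use if' int in auto)
    finally show "(\<Sum>k\<le>n. LINT y|M. norm (f k y)) \<le> (LINT y|M. exp (norm z * \<bar>q y\<bar>) * norm (h y))" .
  qed simp
  then have "(\<lambda>n. integral\<^sup>L M (f n)) sums (LINT y|M. (\<Sum>n. f n y))"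
    using if' s by (intro sums_integral) (auto simp: sums_iff)
  also have "(\<lambda>y. \<Sum>n. f n y) = (\<lambda>y. h y * exp (- \<i> * z * of_real (q y)))"
    using s' by (auto simp: sums_iff)
  also have "(\<lambda>n. integral\<^sup>L M (f n)) =
      (\<lambda>n. (LINT y|M. h y * of_real (q y) ^ n) * ((- \<i>) ^ n / fact n) * z ^ n)"
  proof
    fix n
    have "f n y = h y * of_real (q y) ^ n * ((- \<i>) ^ n / fact n * z ^ n)" for y
      unfolding f_def power_mult_distrib by (simp add: scaleR_conv_of_real divide_inverse mult_ac)
    then have "integral\<^sup>L M (f n) =
        (LINT y|M. h y * of_real (q y) ^ n * ((- \<i>) ^ n / fact n * z ^ n))"
      by (intro Bochner_Integration.integral_cong) auto
    then show "integral\<^sup>L M (f n) =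
        (LINT y|M. h y * of_real (q y) ^ n) * ((- \<i>) ^ n / fact n) * z ^ n"
      by (simp only: integral_mult_left_zero) (simp only: mult.assoc)
  qed
  finally show ?thesis .
qed

lemma exp_minus_i_eq_cis: "exp (- \<i> * of_real t * of_real x) = cis (- (t * x))"
  by (simp add: cis_conv_exp mult.assoc)

lemma moments_zero_imp_cis_integral_zero:
  fixes h :: "'a \<Rightarrow> complex" and q :: "'a \<Rightarrow> real"
  assumes "h \<in> borel_measurable M" "q \<in> borel_measurable M"
    and "\<And>c. integrable M (\<lambda>y. exp (c * \<bar>q y\<bar>) * norm (h y))"
    and "\<And>n. (LINT y|M. h y * of_real (q y) ^ n) = 0"
  shows "(LINT y|M. h y * cis (- (t * q y))) = 0"
  using cis_integral_sums[OF assms(1-3), of "of_real t"] assms(4)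
  unfolding exp_minus_i_eq_cis by (simp add: sums_iff)

text \<open>Identity theorem for the entire function \<open>F\<close>: a nonzero Taylor coefficient
  would make the zero at the origin isolated, whereas \<open>F\<close> vanishes at all small real
  \<open>t\<close>. So all moments vanish, and with them the integral for every
  \<open>t\<close>.\<close>

lemma cis_integral_zero_near_imp_zero:
  fixes h :: "'a \<Rightarrow> complex" and q :: "'a \<Rightarrow> real"
  assumes h: "h \<in> borel_measurable M" "q \<in> borel_measurable M"
    and int: "\<And>c. integrable M (\<lambda>y. exp (c * \<bar>q y\<bar>) * norm (h y))"
    and "d > 0" and 0: "\<And>t. \<bar>t\<bar> < d \<Longrightarrow> (LINT y|M. h y * cis (- (t * q y))) = 0"
  shows "(LINT y|M. h y * cis (- (t * q y))) = 0"
proof (rule moments_zero_imp_cis_integral_zero[OF h int])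
  fix n
  define a where "a n = (LINT y|M. h y * of_real (q y) ^ n) * ((- \<i>) ^ n / fact n)" for n
  define F where "F z = (LINT y|M. h y * exp (- \<i> * z * of_real (q y)))" for z
  have s: "(\<lambda>n. a n * (z - 0) ^ n) sums F z" for z
    using cis_integral_sums[OF h int, of z] by (simp add: a_def F_def)
  have Ft: "F (of_real t) = (LINT y|M. h y * cis (- (t * q y)))" for t
    unfolding F_def exp_minus_i_eq_cis ..
  have F0: "F 0 = 0" using Ft[of 0] 0[of 0] \<open>d > 0\<close> by simp
  have "a n = 0"
  proof (rule ccontr)
    assume an: "a n \<noteq> 0"
    have "a 0 = 0"
      using sums_unique2[OF s[of 0], of "a 0"] F0 powser_sums_zero[of a] by simp
    then have "n > 0" using an by (cases n) auto
    obtain s where s: "0 < s" "\<And>z. z \<in> cball 0 s - {0} \<Longrightarrow> F z \<noteq> 0"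
      using powser_0_nonzero[OF zero_less_one s F0 an \<open>n > 0\<close>] by blast
    define t where "t = min s (d / 2)"
    have "0 < t" "t \<le> s" "t < d" using s(1) \<open>d > 0\<close> by (auto simp: t_def)
    then show False using s(2)[of "of_real t"] 0[of t] Ft[of t] by simp
  qed
  then show "(LINT y|M. h y * of_real (q y) ^ n) = 0" by (simp add: a_def)
qed

lemma continuous_on_fourier:
  fixes h :: "'a::euclidean_space \<Rightarrow> complex"
  assumes h: "integrable lborel h"
  shows "continuous_on UNIV (\<lambda>\<xi>. LINT y|lborel. h y * cis (\<xi> \<bullet> y))"
proof (rule continuous_at_imp_continuous_on, rule ballI, subst continuous_at_sequentially, intro allI impI)
  fix \<xi> :: 'a and X assume X: "X \<longlonglongrightarrow> \<xi>"
  have [measurable]: "h \<in> borel_measurable borel" using h by auto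
  show "((\<lambda>\<xi>. LINT y|lborel. h y * cis (\<xi> \<bullet> y)) \<circ> X) \<longlonglongrightarrow> (LINT y|lborel. h y * cis (\<xi> \<bullet> y))"
    unfolding o_def
  proof (rule integral_dominated_convergence[where w = "\<lambda>y. norm (h y)"])
    have "isCont cis x" for x
      using continuous_on_cis[OF continuous_on_id, of UNIV] by (simp add: continuous_on_eq_continuous_at)
    then show "AE y in lborel. (\<lambda>n. h y * cis (X n \<bullet> y)) \<longlonglongrightarrow> h y * cis (\<xi> \<bullet> y)"
      by (intro AE_I2 tendsto_intros isCont_tendsto_compose[of _ cis] X)
  qed (use h in \<open>auto simp: norm_mult\<close>)
qed

text \<open>Continuity carries the vanishing from \<open>D\<close> to the open set \<open>U\<close>.
  Compact support gives all exponential moments, so the identity theorem applies along each line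
  through a point of \<open>U\<close>.\<close>

lemma compact_support_fourier_unique:
  fixes h :: "'a::euclidean_space \<Rightarrow> complex"
  assumes h: "integrable lborel h" and K: "compact K" "AE u in lborel. u \<notin> K \<longrightarrow> h u = 0"
    and U: "open U" "U \<noteq> {}" "U \<subseteq> closure D"
    and 0: "\<And>\<mu>. \<mu> \<in> D \<Longrightarrow> (LINT u|lborel. h u * cis (- (\<mu> \<bullet> u))) = 0"
  shows "AE u in lborel. h u = 0"
proof (rule fourier_unique[OF h])
  fix \<xi> :: 'a
  have [measurable]: "h \<in> borel_measurable borel" using h by auto
  define F where "F \<mu> = (LINT u|lborel. h u * cis ((- \<mu>) \<bullet> u))" for \<mu>
  have "continuous_on UNIV F"
    unfolding F_def
    by (intro continuous_on_compose2[OF continuous_on_fourier[OF h]] continuous_intros) auto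
  then have "closed (F -` {0})"
    by (simp add: continuous_closed_vimage continuous_on_eq_continuous_at)
  moreover have "D \<subseteq> F -` {0}" using 0 by (auto simp: F_def)
  ultimately have FU: "F \<mu> = 0" if "\<mu> \<in> U" for \<mu>
    using U(3) that closure_minimal by blast
  obtain \<mu>0 where "\<mu>0 \<in> U" using U(2) by blast
  then obtain e where e: "e > 0" "ball \<mu>0 e \<subseteq> U" using U(1) by (auto simp: open_contains_ball)
  obtain B where B: "\<And>u. u \<in> K \<Longrightarrow> norm u \<le> B"
    using compact_imp_bounded[OF K(1)] by (auto simp: bounded_iff)
  \<comment> \<open>The line \<open>\<mu>0 + t *\<^sub>R \<eta>\<close> starts inside
    \<open>U\<close> and reaches the wanted frequency \<open>- \<xi>\<close> at
    \<open>t = 1\<close>.\<close>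
  define \<eta> where "\<eta> = - \<xi> - \<mu>0"
  define h0 where "h0 u = h u * cis ((- \<mu>0) \<bullet> u)" for u
  have [measurable]: "h0 \<in> borel_measurable borel" unfolding h0_def by measurable
  have split: "h0 u * cis (- (t * (\<eta> \<bullet> u))) = h u * cis (- (\<mu>0 + t *\<^sub>R \<eta>) \<bullet> u)" for t u
    by (simp add: h0_def mult.assoc cis_mult inner_simps)
  have "(LINT u|lborel. h0 u * cis (- (1 * (\<eta> \<bullet> u)))) = 0"
  proof (rule cis_integral_zero_near_imp_zero)
    fix c :: real
    show "integrable lborel (\<lambda>u. exp (c * \<bar>\<eta> \<bullet> u\<bar>) * norm (h0 u))"
    proof (rule Bochner_Integration.integrable_bound)
      show "integrable lborel (\<lambda>u. exp (\<bar>c\<bar> * (norm \<eta> * B)) * norm (h u))" using h by auto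
      show "AE u in lborel. norm (exp (c * \<bar>\<eta> \<bullet> u\<bar>) * norm (h0 u))
          \<le> norm (exp (\<bar>c\<bar> * (norm \<eta> * B)) * norm (h u))"
        using K(2)
      proof eventually_elim
        case (elim u)
        show ?case
        proof (cases "u \<in> K")
          case True
          have "c * \<bar>\<eta> \<bullet> u\<bar> \<le> \<bar>c\<bar> * \<bar>\<eta> \<bullet> u\<bar>" by (intro mult_right_mono) auto
          also have "\<dots> \<le> \<bar>c\<bar> * (norm \<eta> * norm u)"
            by (intro mult_left_mono Cauchy_Schwarz_ineq2) auto
          also have "\<dots> \<le> \<bar>c\<bar> * (norm \<eta> * B)"
            by (intro mult_left_mono B True) auto
          finally show ?thesis by (simp add: h0_def norm_mult mult_right_mono)
        qed (use elim in \<open>simp add: h0_def\<close>)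
      qed
    qed simp
  next
    \<comment> \<open>The added 1 keeps the quotient meaningful when
      \<open>\<eta> = 0\<close>.\<close>
    define d where "d = e / (norm \<eta> + 1)"
    show "d > 0" using e(1) by (simp add: d_def add_nonneg_pos)
    fix t :: real assume t: "\<bar>t\<bar> < d"
    have "\<bar>t\<bar> * norm \<eta> \<le> \<bar>t\<bar> * (norm \<eta> + 1)" by (simp add: mult_left_mono)
    also have "\<dots> < e" using t by (simp add: d_def pos_less_divide_eq add_nonneg_pos)
    finally have "\<mu>0 + t *\<^sub>R \<eta> \<in> U" using e(2) by (auto simp: dist_norm)
    then show "(LINT u|lborel. h0 u * cis (- (t * (\<eta> \<bullet> u)))) = 0"
      unfolding split using FU by (simp only: F_def)
  qed auto
  then show "(LINT u|lborel. h u * cis (\<xi> \<bullet> u)) = 0"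
    unfolding split by (simp add: \<eta>_def)
qed

section \<open>The partial Fourier transform in the central variable\<close>

definition central_fourier ::
    "('v::euclidean_space \<times> 'z::euclidean_space \<Rightarrow> complex) \<Rightarrow> 'z \<Rightarrow> 'v \<Rightarrow> complex" where
  "central_fourier f \<mu> x = (LINT u|lborel. f (x, u) * cis (- (\<mu> \<bullet> u)))"

text \<open>The exceptional null set of \<open>x\<close> depends on \<open>\<mu>\<close>.
  Restricting to a countable dense subset \<open>D\<close> of \<open>U\<close> gives one null set
  for all characters used, after which the previous uniqueness result applies to almost every
  slice.\<close>

lemma central_fourier_unique:
  fixes f :: "'v::euclidean_space \<times> 'z::euclidean_space \<Rightarrow> complex"
  assumes f: "integrable lborel f" and K: "compact K" "central_supp f K"
    and U: "open U" "U \<noteq> {}"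
    and 0: "\<And>\<mu>. \<mu> \<in> U \<Longrightarrow> AE x in lborel. central_fourier f \<mu> x = 0"
  shows "AE g in lborel. f g = 0"
proof -
  obtain D where D: "countable D" "D \<subseteq> U" "U \<subseteq> closure D" by (rule separable)
  have f': "integrable (lborel \<Otimes>\<^sub>M lborel) f" using f by (simp add: lborel_prod)
  have [measurable]: "f \<in> borel_measurable (lborel \<Otimes>\<^sub>M lborel)" using f' by auto
  have "AE x in lborel. \<forall>\<mu>\<in>D. central_fourier f \<mu> x = 0"
    using 0 D by (subst AE_ball_countable) auto
  moreover have "AE x in lborel. integrable lborel (\<lambda>u. f (x, u))"
    by (rule lborel_pair.AE_integrable_fst'[OF f'])
  moreover have "AE x in lborel. AE u in lborel. (x, u) \<notin> UNIV \<times> K \<longrightarrow> f (x, u) = 0"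
    using K(2) unfolding central_supp_def lborel_prod[symmetric] by (rule lborel_pair.AE_pair)
  ultimately have "AE x in lborel. AE u in lborel. f (x, u) = 0"
  proof eventually_elim
    case (elim x)
    show ?case
      by (rule compact_support_fourier_unique[OF elim(2) K(1) _ U D(3)]) (use elim in \<open>auto simp: central_fourier_def\<close>)
  qed
  then have "AE g in lborel \<Otimes>\<^sub>M lborel. f g = 0"
    by (intro lborel_pair.AE_pair_measure) measurable
  then show ?thesis by (simp only: lborel_prod)
qed

section \<open>Geometry of the circles\<close>

lemma hbr_self:
  assumes "H_type br" shows "hbr br V V = 0"
  using assms by (simp add: H_type_def lie_bracket_def hbr_def)

lemma H_type_bilinear: "H_type br \<Longrightarrow> bilinear (hbr br)"
  by (auto simp: H_type_def lie_bracket_def intro: bilinear_hbr)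

lemma hbr_antisym:
  assumes "H_type br" shows "hbr br V W = - hbr br W V"
proof -
  note b = H_type_bilinear[OF assms]
  have "hbr br (V + W) (V + W) = hbr br V V + hbr br W W + (hbr br V W + hbr br W V)"
    by (simp add: bilinear_ladd[OF b] bilinear_radd[OF b])
  then show ?thesis by (simp add: hbr_self[OF assms] eq_neg_iff_add_eq_0)
qed

lemma Jmap_skew:
  assumes "H_type br" shows "Jmap br \<mu> V \<bullet> W = - (V \<bullet> Jmap br \<mu> W)"
  using hbr_antisym[OF assms, of V W] by (simp add: Jmap_inner[OF assms] inner_commute[of V])

lemma Jmap_Jmap: "H_type br \<Longrightarrow> Jmap br \<mu> (Jmap br \<mu> V) = - ((norm \<mu>)\<^sup>2 *\<^sub>R V)"
  by (simp add: H_type_def)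

lemma Jmap_inner_Jmap:
  assumes "H_type br" shows "Jmap br \<mu> V \<bullet> Jmap br \<mu> V = (norm \<mu>)\<^sup>2 * (V \<bullet> V)"
  by (simp add: Jmap_skew[OF assms] Jmap_Jmap[OF assms])

lemma Jmap_add_left:
  assumes "H_type br" shows "Jmap br (\<mu> + \<kappa>) V = Jmap br \<mu> V + Jmap br \<kappa> V"
  by (rule vector_eq_rdot[THEN iffD1]) (simp add: inner_add_left Jmap_inner[OF assms])

text \<open>Polarization in the covector of the identity
  \<open>|Jmap br \<mu> V| = |\<mu>| |V|\<close>.\<close>

lemma Jmap_orthogonal:
  assumes "H_type br" and "\<mu> \<bullet> \<kappa> = 0" shows "Jmap br \<mu> V \<bullet> Jmap br \<kappa> V = 0"
proof -
  have "Jmap br (\<mu> + \<kappa>) V \<bullet> Jmap br (\<mu> + \<kappa>) V =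
      Jmap br \<mu> V \<bullet> Jmap br \<mu> V + Jmap br \<kappa> V \<bullet> Jmap br \<kappa> V + 2 * (Jmap br \<mu> V \<bullet> Jmap br \<kappa> V)"
    by (simp add: Jmap_add_left[OF assms(1)] inner_add_left inner_add_right inner_commute)
  moreover have "(norm (\<mu> + \<kappa>))\<^sup>2 = (norm \<mu>)\<^sup>2 + (norm \<kappa>)\<^sup>2"
    using assms(2) by (simp add: power2_norm_eq_inner inner_add_left inner_add_right inner_commute)
  ultimately show ?thesis by (simp add: Jmap_inner_Jmap[OF assms(1)] distrib_right)
qed

text \<open>The vector \<open>e\<close> is \<open>norm lam\<close> times the preimage of
  \<open>\<nu>\<close> under \<open>Jmap br lam\<close>. In the orthonormal frame \<open>e\<close>,
  \<open>\<nu>\<close> the horizontal part of the curve is a circle of radius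
  \<open>1 / norm lam\<close>.\<close>

lemma gcurve_circle:
  fixes br :: "('v::euclidean_space, 'z::euclidean_space) bracket"
  assumes H: "H_type br" and "lam \<noteq> 0" and "norm \<nu> = 1"
  obtains e where "norm e = 1" "e \<bullet> \<nu> = 0"
    "Jmap br lam e = norm lam *\<^sub>R \<nu>" "Jmap br lam \<nu> = - (norm lam *\<^sub>R e)"
    "\<And>s. gcurve br \<nu> lam s =
       ((1 / norm lam) *\<^sub>R (cos (norm lam * s) *\<^sub>R e + sin (norm lam * s) *\<^sub>R \<nu>), (s / (2 * norm lam)) *\<^sub>R sgn lam)"
proof -
  let ?J = "Jmap br lam" and ?r = "norm lam"
  have r: "?r > 0" using assms by auto
  note l = linear_Jmap[OF H]
  define e where "e = - ((1 / ?r) *\<^sub>R ?J \<nu>)"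
  have Je: "?J e = ?r *\<^sub>R \<nu>"
    using r by (simp add: e_def linear_neg[OF l] linear_scale[OF l] Jmap_Jmap[OF H] power2_eq_square)
  have "inj ?J"
  proof (rule injI)
    fix x y assume "?J x = ?J y"
    then have "?J (?J x) = ?J (?J y)" by simp
    then show "x = y" using r by (simp add: Jmap_Jmap[OF H])
  qed
  then have inv: "inv ?J \<nu> = (1 / ?r) *\<^sub>R e"
    using r by (intro inv_f_eq) (simp_all add: linear_scale[OF l] Je)
  show ?thesis
  proof (rule that[of e])
    have "e \<bullet> e = 1"
      using r \<open>norm \<nu> = 1\<close> by (simp add: e_def Jmap_inner_Jmap[OF H] power2_eq_square norm_eq_1)
    then show "norm e = 1" by (simp add: norm_eq_1)
    show "e \<bullet> \<nu> = 0" by (simp add: e_def Jmap_inner[OF H] hbr_self[OF H])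
    show "?J \<nu> = - (?r *\<^sub>R e)" using r by (simp add: e_def)
    show "gcurve br \<nu> lam s = ((1 / ?r) *\<^sub>R (cos (?r * s) *\<^sub>R e + sin (?r * s) *\<^sub>R \<nu>), (s / (2 * ?r)) *\<^sub>R sgn lam)" for s
      using r unfolding gcurve_def lin_exp_Jmap[OF H \<open>lam \<noteq> 0\<close>] inv
      by (simp add: linear_scale[OF l] Je scaleR_add_right mult.commute)
  qed (rule Je)
qed

lemma continuous_on_hbr:
  assumes "H_type br" "continuous_on S F" "continuous_on S G"
  shows "continuous_on S (\<lambda>p. hbr br (F p) (G p))"
  using H_type_bilinear[OF assms(1)] assms(2,3)
  unfolding bilinear_conv_bounded_bilinear by (rule bounded_bilinear.continuous_on)

lemma continuous_on_gmult:
  assumes "H_type br" "continuous_on S F" "continuous_on S G"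
  shows "continuous_on S (\<lambda>p. gmult br (F p) (G p))"
  unfolding gmult_def by (intro continuous_intros continuous_on_hbr assms)

lemma gmult_uminus:
  assumes "H_type br"
  shows "gmult br (gmult br g h) (- h) = g"
proof -
  note b = H_type_bilinear[OF assms]
  show ?thesis
    by (simp add: gmult_def bilinear_ladd[OF b] bilinear_rneg[OF b] hbr_self[OF assms] prod_eq_iff)
qed

section \<open>Duality for the X-ray transform\<close>

lemma nn_integral_lborel_translate:
  fixes F :: "'a::euclidean_space \<Rightarrow> ennreal"
  assumes [measurable]: "F \<in> borel_measurable borel"
  shows "(\<integral>\<^sup>+u. F (c + u) \<partial>lborel) = (\<integral>\<^sup>+u. F u \<partial>lborel)"
proof -
  have "(\<integral>\<^sup>+u. F u \<partial>lborel) = (\<integral>\<^sup>+u. F u \<partial>(distr lborel borel ((+) c)))"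
    by (simp only: lborel_distr_plus)
  also have "\<dots> = (\<integral>\<^sup>+u. F (c + u) \<partial>lborel)" by (rule nn_integral_distr) auto
  finally show ?thesis ..
qed

text \<open>Right translation shifts \<open>u\<close> by an amount depending on \<open>x\<close>
  alone and shifts \<open>x\<close> by a constant. Integrating first over \<open>u\<close> and then
  over \<open>x\<close>, both shifts disappear.\<close>

lemma distr_gmult:
  fixes br :: "('v::euclidean_space, 'z::euclidean_space) bracket"
  assumes H: "H_type br"
  shows "distr lborel borel (\<lambda>g. gmult br g h) = lborel"
proof (rule measure_eqI)
  fix A :: "('v \<times> 'z) set" assume "A \<in> sets (distr lborel borel (\<lambda>g. gmult br g h))"
  then have A[measurable]: "A \<in> sets borel" by simp
  have m[measurable]: "(\<lambda>g. gmult br g h) \<in> borel_measurable borel"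
    by (intro borel_measurable_continuous_onI continuous_on_gmult H continuous_intros)
  have m'[measurable]: "(\<lambda>g. gmult br g h) \<in> borel \<Otimes>\<^sub>M borel \<rightarrow>\<^sub>M borel" using m by (simp add: borel_prod)
  have A'[measurable]: "A \<in> sets (borel \<Otimes>\<^sub>M borel)" using A by (simp only: borel_prod)
  have "emeasure (distr lborel borel (\<lambda>g. gmult br g h)) A = (\<integral>\<^sup>+g. indicator A g \<partial>(distr lborel borel (\<lambda>g. gmult br g h)))"
    by simp
  also have "\<dots> = (\<integral>\<^sup>+g. indicator A (gmult br g h) \<partial>lborel)"
    by (rule nn_integral_distr) auto
  also have "\<dots> = (\<integral>\<^sup>+x. \<integral>\<^sup>+u. indicator A (gmult br (x, u) h) \<partial>lborel \<partial>lborel)"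
    unfolding lborel_prod[symmetric] by (subst lborel.nn_integral_fst[symmetric]) (simp_all add: lborel_prod)
  also have "\<dots> = (\<integral>\<^sup>+x. \<integral>\<^sup>+u. indicator A (fst h + x, (snd h + (1/2) *\<^sub>R hbr br x (fst h)) + u) \<partial>lborel \<partial>lborel)"
    by (simp add: gmult_def add_ac)
  also have "\<dots> = (\<integral>\<^sup>+x. \<integral>\<^sup>+u. indicator A (fst h + x, u) \<partial>lborel \<partial>lborel)"
  proof (rule nn_integral_cong)
    fix x :: 'v
    show "(\<integral>\<^sup>+u. indicator A (fst h + x, (snd h + (1/2) *\<^sub>R hbr br x (fst h)) + u) \<partial>lborel) =
        (\<integral>\<^sup>+u. indicator A (fst h + x, u) \<partial>lborel)"
      by (rule nn_integral_lborel_translate) measurable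
  qed
  also have "\<dots> = (\<integral>\<^sup>+x. \<integral>\<^sup>+u. indicator A (x, u) \<partial>lborel \<partial>lborel)"
    by (rule nn_integral_lborel_translate) measurable
  also have "\<dots> = (\<integral>\<^sup>+g. indicator A g \<partial>lborel)"
    unfolding lborel_prod[symmetric] by (subst lborel.nn_integral_fst) measurable
  finally show "emeasure (distr lborel borel (\<lambda>g. gmult br g h)) A = emeasure lborel A" by simp
qed simp

section \<open>Unfolding integrals between two fundamental domains\<close>

text \<open>Every orbit meets \<open>E'\<close> exactly once, so 1 is the sum over \<open>j\<close>
  of \<open>indicator E' (\<tau> j p)\<close>. Inserting this, substituting
  \<open>\<tau> (- j) p\<close> for \<open>p\<close> in each term and summing again turns
  \<open>E\<close> into \<open>E'\<close>.\<close>

lemma nn_integral_fundamental_domains: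
  fixes \<tau> :: "int \<Rightarrow> 'a \<Rightarrow> 'a" and Q :: "'a \<Rightarrow> ennreal"
  assumes [measurable]: "\<And>j. \<tau> j \<in> M \<rightarrow>\<^sub>M M" and inv: "\<And>j. distr M M (\<tau> j) = M"
    and \<tau>: "\<And>j p. p \<in> space M \<Longrightarrow> \<tau> j (\<tau> (- j) p) = p"
    and [measurable]: "Q \<in> borel_measurable M" and Q: "\<And>j p. p \<in> space M \<Longrightarrow> Q (\<tau> j p) = Q p"
    and [measurable]: "E \<in> sets M" "E' \<in> sets M"
    and E: "\<And>p. p \<in> space M \<Longrightarrow> \<exists>!j. \<tau> j p \<in> E" and E': "\<And>p. p \<in> space M \<Longrightarrow> \<exists>!j. \<tau> j p \<in> E'"
  shows "(\<integral>\<^sup>+p. Q p * indicator E p \<partial>M) = (\<integral>\<^sup>+p. Q p * indicator E' p \<partial>M)"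
proof -
  have one: "(\<integral>\<^sup>+j. c * indicator A (g j) \<partial>count_space UNIV) = c"
    if "\<exists>!j. g j \<in> A" for c :: ennreal and A :: "'a set" and g :: "int \<Rightarrow> 'a"
  proof -
    obtain j0 where "\<And>j. g j \<in> A \<longleftrightarrow> j = j0" using \<open>\<exists>!j. g j \<in> A\<close> by metis
    then have "indicator A (g j) = (indicator {j0} j :: ennreal)" for j
      by (simp add: indicator_def)
    then have "(\<integral>\<^sup>+j. c * indicator A (g j) \<partial>count_space UNIV) =
        (\<integral>\<^sup>+j. c * indicator {j0} j \<partial>count_space UNIV)" by simp
    also have "\<dots> = c" by (subst nn_integral_cmult_indicator) auto
    finally show ?thesis .
  qed
  have "(\<integral>\<^sup>+p. Q p * indicator E p \<partial>M) =
      (\<integral>\<^sup>+p. \<integral>\<^sup>+j. (Q p * indicator E p) * indicator E' (\<tau> j p) \<partial>count_space UNIV \<partial>M)"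
    by (intro nn_integral_cong) (simp add: one E')
  also have "\<dots> = (\<integral>\<^sup>+j. \<integral>\<^sup>+p. (Q p * indicator E p) * indicator E' (\<tau> j p) \<partial>M \<partial>count_space UNIV)"
    by (intro nn_integral_count_space_nn_integral) auto
  also have "\<dots> = (\<integral>\<^sup>+j. \<integral>\<^sup>+p. (Q p * indicator E' p) * indicator E (\<tau> (- j) p) \<partial>M \<partial>count_space UNIV)"
  proof (rule nn_integral_cong)
    fix j
    have "(\<integral>\<^sup>+p. (Q p * indicator E p) * indicator E' (\<tau> j p) \<partial>M) =
        (\<integral>\<^sup>+p. (Q p * indicator E p) * indicator E' (\<tau> j p) \<partial>(distr M M (\<tau> (- j))))"
      by (simp only: inv)
    also have "\<dots> = (\<integral>\<^sup>+p. (Q (\<tau> (- j) p) * indicator E (\<tau> (- j) p)) * indicator E' (\<tau> j (\<tau> (- j) p)) \<partial>M)"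
      by (rule nn_integral_distr) auto
    also have "\<dots> = (\<integral>\<^sup>+p. (Q p * indicator E' p) * indicator E (\<tau> (- j) p) \<partial>M)"
      by (intro nn_integral_cong) (simp add: \<tau> Q mult_ac)
    finally show "(\<integral>\<^sup>+p. (Q p * indicator E p) * indicator E' (\<tau> j p) \<partial>M) =
        (\<integral>\<^sup>+p. (Q p * indicator E' p) * indicator E (\<tau> (- j) p) \<partial>M)" .
  qed
  also have "\<dots> = (\<integral>\<^sup>+p. \<integral>\<^sup>+j. (Q p * indicator E' p) * indicator E (\<tau> (- j) p) \<partial>count_space UNIV \<partial>M)"
    by (intro nn_integral_count_space_nn_integral[symmetric]) auto
  also have "\<dots> = (\<integral>\<^sup>+p. Q p * indicator E' p \<partial>M)"
  proof (intro nn_integral_cong one)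
    fix p assume "p \<in> space M"
    then obtain j where "\<And>k. \<tau> k p \<in> E \<longleftrightarrow> k = j" using E by metis
    then show "\<exists>!j. \<tau> (- j) p \<in> E" by (intro ex1I[of _ "- j"]) auto
  qed
  finally show ?thesis .
qed

text \<open>The nonnegative case is applied to the norm of \<open>Q\<close>, which gives
  integrability, and to the positive and negative parts of its real and imaginary parts.\<close>

lemma integral_fundamental_domains:
  fixes \<tau> :: "int \<Rightarrow> 'a \<Rightarrow> 'a" and Q :: "'a \<Rightarrow> complex"
  assumes \<tau>: "\<And>j. \<tau> j \<in> M \<rightarrow>\<^sub>M M" "\<And>j. distr M M (\<tau> j) = M"
    "\<And>j p. p \<in> space M \<Longrightarrow> \<tau> j (\<tau> (- j) p) = p"
    and Qm[measurable]: "Q \<in> borel_measurable M" and Q: "\<And>j p. p \<in> space M \<Longrightarrow> Q (\<tau> j p) = Q p"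
    and E: "E \<in> sets M" "E' \<in> sets M"
      "\<And>p. p \<in> space M \<Longrightarrow> \<exists>!j. \<tau> j p \<in> E" "\<And>p. p \<in> space M \<Longrightarrow> \<exists>!j. \<tau> j p \<in> E'"
    and int: "set_integrable M E' Q"
  shows "set_integrable M E Q" "(LINT p:E|M. Q p) = (LINT p:E'|M. Q p)"
proof -
  note [measurable] = E(1,2)
  have nn: "(\<integral>\<^sup>+p. ennreal (F (Q p)) * indicator E p \<partial>M) = (\<integral>\<^sup>+p. ennreal (F (Q p)) * indicator E' p \<partial>M)"
    if [measurable]: "F \<in> borel_measurable borel" for F :: "complex \<Rightarrow> real"
    using Q by (intro nn_integral_fundamental_domains[OF \<tau> _ _ E]) auto
  have nrm: "ennreal (norm (indicator A p *\<^sub>R Q p)) = ennreal (norm (Q p)) * indicator A p" for A p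
    by (simp add: indicator_def)
  have "(\<integral>\<^sup>+p. ennreal (norm (indicator E' p *\<^sub>R Q p)) \<partial>M) < \<infinity>"
    using int unfolding set_integrable_def integrable_iff_bounded by blast
  then show E': "set_integrable M E Q"
    unfolding set_integrable_def integrable_iff_bounded nrm nn[OF borel_measurable_continuous_onI[OF continuous_on_norm_id]]
    by simp
  have eq: "(LINT p|M. indicator E p * F (Q p)) = (LINT p|M. indicator E' p * F (Q p))"
    if F: "bounded_linear F" for F :: "complex \<Rightarrow> real"
  proof -
    have [measurable]: "F \<in> borel_measurable borel"
      using F by (intro borel_measurable_continuous_onI linear_continuous_on)
    have i: "integrable M (\<lambda>p. indicator A p * F (Q p))" if "set_integrable M A Q" for A
      using integrable_bounded_linear[OF F that[unfolded set_integrable_def]]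
      by (simp add: linear_scale[OF bounded_linear.linear[OF F]])
    have en: "ennreal (indicator A p * y) = ennreal y * indicator A p"
      "ennreal (- (indicator A p * y)) = ennreal (- y) * indicator A p" for A and p :: 'a and y
      by (auto simp: indicator_def)
    show ?thesis
      unfolding real_lebesgue_integral_def[OF i[OF E']] real_lebesgue_integral_def[OF i[OF int]] en
      using nn[of F] nn[of "\<lambda>z. - F z"] by simp
  qed
  have p: "(LINT p:A|M. Q p) = Complex (LINT p|M. indicator A p * Re (Q p)) (LINT p|M. indicator A p * Im (Q p))"
    if "set_integrable M A Q" for A
    using integral_Re[OF that[unfolded set_integrable_def]] integral_Im[OF that[unfolded set_integrable_def]]
    by (simp add: set_lebesgue_integral_def complex_eq_iff)
  show "(LINT p:E|M. Q p) = (LINT p:E'|M. Q p)"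
    unfolding p[OF E'] p[OF int] by (simp add: eq bounded_linear_Re bounded_linear_Im)
qed

text \<open>Moves vanishing in the quotient to coset representatives: the quotient measure is by
  construction the image of the measure on the fundamental domain.\<close>

lemma AE_quotD:
  fixes br :: "('v::euclidean_space, 'z::euclidean_space) bracket"
  assumes "AE C in quot br lam. P C"
  shows "AE g in lborel. g \<in> fund_domain lam \<longrightarrow> P (gcoset br lam g)"
proof -
  obtain N where N: "{C \<in> space (quot br lam). \<not> P C} \<subseteq> N" "N \<in> sets (quot br lam)"
    "emeasure (quot br lam) N = 0"
    using assms by (auto elim: AE_E)
  show ?thesis
  proof (rule AE_I)
    have "space (quot br lam) = range (gcoset br lam)"
      by (simp add: quot_def space_measure_of_conv)
    then show "{g \<in> space lborel. \<not> (g \<in> fund_domain lam \<longrightarrow> P (gcoset br lam g))}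
        \<subseteq> gcoset br lam -` N \<inter> fund_domain lam"
      using N(1) by (intro subsetI) blast
    show "emeasure lborel (gcoset br lam -` N \<inter> fund_domain lam) = 0"
      using emeasure_quot[OF N(2)] N(3) by simp
    have [measurable]: "(\<lambda>g :: 'v \<times> 'z. snd g \<bullet> sgn lam) \<in> borel_measurable borel"
      by (intro borel_measurable_continuous_onI continuous_intros)
    have "fund_domain lam \<in> sets (borel :: ('v \<times> 'z) measure)"
      unfolding fund_domain_def by measurable
    then show "gcoset br lam -` N \<inter> fund_domain lam \<in> sets lborel"
      using N(2) by (intro sets.Int) (auto simp: sets_quot)
  qed
qed

lemma integral_gmult:
  fixes br :: "('v::euclidean_space, 'z::euclidean_space) bracket" and F :: "'v \<times> 'z \<Rightarrow> complex"
  assumes H: "H_type br" and [measurable]: "F \<in> borel_measurable borel"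
  shows "(LINT g|lborel. F (gmult br g h)) = (LINT g|lborel. F g)"
proof -
  have [measurable]: "(\<lambda>g. gmult br g h) \<in> borel_measurable borel"
    by (intro borel_measurable_continuous_onI continuous_on_gmult H continuous_intros)
  have "(LINT g|lborel. F g) = (LINT g|distr lborel borel (\<lambda>g. gmult br g h). F g)"
    by (simp only: distr_gmult[OF H])
  also have "\<dots> = (LINT g|lborel. F (gmult br g h))" by (rule integral_distr) auto
  finally show ?thesis ..
qed

lemma nn_integral_gmult:
  fixes br :: "('v::euclidean_space, 'z::euclidean_space) bracket" and F :: "'v \<times> 'z \<Rightarrow> ennreal"
  assumes H: "H_type br" and [measurable]: "F \<in> borel_measurable borel"
  shows "(\<integral>\<^sup>+g. F (gmult br g h) \<partial>lborel) = (\<integral>\<^sup>+g. F g \<partial>lborel)"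
proof -
  have [measurable]: "(\<lambda>g. gmult br g h) \<in> borel_measurable borel"
    by (intro borel_measurable_continuous_onI continuous_on_gmult H continuous_intros)
  have "(\<integral>\<^sup>+g. F g \<partial>lborel) = (\<integral>\<^sup>+g. F g \<partial>distr lborel borel (\<lambda>g. gmult br g h))"
    by (simp only: distr_gmult[OF H])
  also have "\<dots> = (\<integral>\<^sup>+g. F (gmult br g h) \<partial>lborel)" by (rule nn_integral_distr) auto
  finally show ?thesis ..
qed

lemma ex1_int_interval:
  fixes a d :: real assumes "d > 0"
  shows "\<exists>!j::int. 0 \<le> a + of_int j * d \<and> a + of_int j * d < d"
proof (rule ex1I[of _ "- \<lfloor>a / d\<rfloor>"])
  show "0 \<le> a + of_int (- \<lfloor>a / d\<rfloor>) * d \<and> a + of_int (- \<lfloor>a / d\<rfloor>) * d < d"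
    using floor_divide_lower[OF assms, of a] floor_divide_upper[OF assms, of a] by (simp add: distrib_right)
next
  fix j :: int assume "0 \<le> a + of_int j * d \<and> a + of_int j * d < d"
  then have "of_int (- j) \<le> a / d" "a / d < of_int (- j) + 1"
    using assms by (simp_all add: field_simps)
  then have "\<lfloor>a / d\<rfloor> = - j" by (rule floor_unique)
  then show "j = - \<lfloor>a / d\<rfloor>" by simp
qed

text \<open>
  The integral over \<open>G / \<Gamma>\<close> of a full line integral is unfolded: on \<open>G \<times> \<real>\<close> the integrand
  \<open>\<psi> g * f (g \<gamma>(s))\<close> is invariant under shifting \<open>s\<close> by a period of the circle and \<open>g\<close> by the
  opposite central translation. Both \<open>fund_domain lam \<times> \<real>\<close> and \<open>G \<times> [0, P)\<close> are fundamental
  domains of this action, \<open>P\<close> being the period. Note that \<open>- gcurve br \<nu> lam s\<close> is the group inverse.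
\<close>

theorem xray_zero_duality:
  fixes br :: "('v::euclidean_space, 'z::euclidean_space) bracket"
    and f \<psi> :: "'v \<times> 'z \<Rightarrow> complex"
  assumes H: "H_type br" and lam: "lam \<noteq> 0" and \<nu>: "norm \<nu> = 1"
    and f: "integrable lborel f"
    and xray: "AE C in quot br lam. xray br \<nu> lam f C = 0"
    and \<psi>[measurable]: "\<psi> \<in> borel_measurable borel" and B: "\<And>g. norm (\<psi> g) \<le> B"
    and per: "\<And>j x u. \<psi> (x, u + (of_int j * (pi / (norm lam)\<^sup>2)) *\<^sub>R sgn lam) = \<psi> (x, u)"
  shows "(LINT g|lborel. f g * (LINT s:{0..<2 * pi / norm lam}|lborel. \<psi> (gmult br g (- gcurve br \<nu> lam s)))) = 0"
proof -
  let ?r = "norm lam" and ?\<gamma> = "gcurve br \<nu> lam"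
  note lp = lborel_prod[symmetric, where ?'a = "'v \<times> 'z" and ?'b = real]
  \<comment> \<open>\<open>T\<close> is the spacing of the central lattice and \<open>P\<close> the
    period of the circle; during one period the curve climbs by exactly \<open>T\<close> in the
    direction \<open>sgn lam\<close>.\<close>
  define T where "T = pi / ?r\<^sup>2"
  define P where "P = 2 * pi / ?r"
  have r: "?r > 0" using lam by simp
  have T: "T > 0" and P: "P > 0" using r by (simp_all add: T_def P_def)
  obtain e where \<gamma>: "\<And>s. ?\<gamma> s =
      ((1 / ?r) *\<^sub>R (cos (?r * s) *\<^sub>R e + sin (?r * s) *\<^sub>R \<nu>), (s / (2 * ?r)) *\<^sub>R sgn lam)"
    by (rule gcurve_circle[OF H lam \<nu>]) blast
  have c\<gamma>: "continuous_on UNIV ?\<gamma>" unfolding \<gamma> using r by (intro continuous_intros) auto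
  have \<gamma>P: "?\<gamma> (s - of_int j * P) = ?\<gamma> s - (0, (of_int j * T) *\<^sub>R sgn lam)" for s j
  proof -
    have "?r * (s - of_int j * P) = ?r * s - 2 * pi * of_int j"
      using r by (simp add: P_def field_simps)
    then have "cos (?r * (s - of_int j * P)) = cos (?r * s)" "sin (?r * (s - of_int j * P)) = sin (?r * s)"
      by (simp_all add: cos_diff sin_diff mult.commute[of _ "of_int j"] mult.assoc
          cos_int_2pin[unfolded mult.commute[of "2 * pi"]] sin_int_2pin[unfolded mult.commute[of "2 * pi"]])
    moreover have "(s - of_int j * P) / (2 * ?r) = s / (2 * ?r) - of_int j * T"
      using r by (simp add: P_def T_def field_simps power2_eq_square)
    ultimately show ?thesis unfolding \<gamma> by (simp add: scaleR_diff_left)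
  qed
  have [measurable]: "f \<in> borel_measurable borel" using f by auto
  have m1[measurable]: "(\<lambda>p. gmult br (fst p) (?\<gamma> (snd p))) \<in> borel_measurable borel"
    by (intro borel_measurable_continuous_onI continuous_on_gmult[OF H] continuous_intros
        continuous_on_compose2[OF c\<gamma>]) auto
  have m2[measurable]: "(\<lambda>p. gmult br (fst p) (- ?\<gamma> (snd p))) \<in> borel_measurable borel"
    by (intro borel_measurable_continuous_onI continuous_on_gmult[OF H] continuous_intros
        continuous_on_compose2[OF c\<gamma>]) auto
  have fs[measurable]: "fst \<in> borel_measurable (borel :: (('v \<times> 'z) \<times> real) measure)"
    "snd \<in> borel_measurable (borel :: (('v \<times> 'z) \<times> real) measure)"
    by (intro borel_measurable_continuous_onI continuous_intros)+
  define Q where "Q p = \<psi> (fst p) * f (gmult br (fst p) (?\<gamma> (snd p)))" for p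
  have Qm[measurable]: "Q \<in> borel_measurable borel" unfolding Q_def by measurable
  define \<tau> where "\<tau> j p = (((0, (of_int j * T) *\<^sub>R sgn lam), - of_int j * P) :: ('v \<times> 'z) \<times> real) + p" for j :: int and p
  define D :: "('v \<times> 'z) set" where "D = fund_domain lam"
  have D[measurable]: "D \<in> sets borel"
  proof -
    have [measurable]: "(\<lambda>g :: 'v \<times> 'z. snd g \<bullet> sgn lam) \<in> borel_measurable borel"
      by (intro borel_measurable_continuous_onI continuous_intros)
    show ?thesis unfolding D_def fund_domain_def by measurable
  qed
  define E where "E = D \<times> (UNIV :: real set)"
  define E' where "E' = (UNIV :: ('v \<times> 'z) set) \<times> {0..<P}"
  have Em: "E \<in> sets borel" "E' \<in> sets borel"
    using pair_measureI[of D borel "UNIV :: real set" borel] pair_measureI[of "UNIV :: ('v \<times> 'z) set" borel "{0..<P}" borel]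
    unfolding E_def E'_def borel_prod by auto
  have ss: "sgn lam \<bullet> sgn lam = 1" using r by (simp add: sgn_div_norm power2_norm_eq_inner[symmetric] power2_eq_square)
  \<comment> \<open>Integrability is checked on \<open>E'\<close>, where \<open>s\<close> is
    confined to a bounded interval and right invariance bounds each slice by \<open>B\<close> times
    the L1 norm of \<open>f\<close>. It then passes to \<open>E\<close>, where \<open>s\<close> is
    unbounded.\<close>
  have nnQ: "set_integrable lborel E' Q"
  proof -
    have "(\<integral>\<^sup>+p. ennreal (norm (indicator E' p *\<^sub>R Q p)) \<partial>lborel) =
      (\<integral>\<^sup>+s. \<integral>\<^sup>+g. ennreal (norm (indicator E' (g, s) *\<^sub>R Q (g, s))) \<partial>lborel \<partial>lborel)"
      unfolding lp using Em
      by (subst lborel_pair.nn_integral_snd) (simp_all add: lborel_prod)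
    also have "\<dots> \<le> (\<integral>\<^sup>+s. (\<integral>\<^sup>+g. ennreal (B * norm (f g)) \<partial>lborel) * indicator {0..<P} s \<partial>lborel)"
    proof (rule nn_integral_mono)
      fix s :: real
      have "(\<integral>\<^sup>+g. ennreal (norm (indicator E' (g, s) *\<^sub>R Q (g, s))) \<partial>lborel) \<le>
          (\<integral>\<^sup>+g. ennreal (B * norm (f (gmult br g (?\<gamma> s)))) * indicator {0..<P} s \<partial>lborel)"
        using B by (intro nn_integral_mono)
          (auto simp: E'_def Q_def norm_mult indicator_def intro!: ennreal_leI mult_right_mono)
      also have "\<dots> = (\<integral>\<^sup>+g. ennreal (B * norm (f (gmult br g (?\<gamma> s)))) \<partial>lborel) * indicator {0..<P} s"
        by (simp add: indicator_def)
      also have "(\<integral>\<^sup>+g. ennreal (B * norm (f (gmult br g (?\<gamma> s)))) \<partial>lborel) = (\<integral>\<^sup>+g. ennreal (B * norm (f g)) \<partial>lborel)"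
        by (rule nn_integral_gmult[OF H]) measurable
      finally show "(\<integral>\<^sup>+g. ennreal (norm (indicator E' (g, s) *\<^sub>R Q (g, s))) \<partial>lborel) \<le>
          (\<integral>\<^sup>+g. ennreal (B * norm (f g)) \<partial>lborel) * indicator {0..<P} s" .
    qed
    also have "\<dots> = (\<integral>\<^sup>+g. ennreal (B * norm (f g)) \<partial>lborel) * ennreal P"
      using P by (subst nn_integral_cmult_indicator) auto
    also have "\<dots> < \<infinity>"
    proof -
      have "B \<ge> 0" using B norm_ge_zero order_trans by blast
      then have "integrable lborel (\<lambda>g. B * norm (f g))" "\<And>g. 0 \<le> B * norm (f g)" using f by auto
      then show ?thesis
        by (simp add: nn_integral_eq_integral ennreal_mult_less_top)
    qed
    finally show ?thesis
      unfolding set_integrable_def using Em by (intro integrableI_bounded) auto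
  qed
  have fd: "set_integrable lborel E Q" "(LINT p:E|lborel. Q p) = (LINT p:E'|lborel. Q p)"
  proof -
    have 1: "\<tau> j \<in> lborel \<rightarrow>\<^sub>M lborel" for j unfolding \<tau>_def by measurable
    have 2: "distr lborel lborel (\<tau> j) = lborel" for j
      unfolding \<tau>_def using lborel_distr_plus[of "((0, (of_int j * T) *\<^sub>R sgn lam), - of_int j * P) :: ('v \<times> 'z) \<times> real"]
      by (simp cong: distr_cong)
    have 3: "\<tau> j (\<tau> (- j) p) = p" for j p by (simp add: \<tau>_def prod_eq_iff)
    have 4: "Q (\<tau> j p) = Q p" for j p
    proof -
      have "fst (\<tau> j p) = (fst (fst p), snd (fst p) + (of_int j * (pi / ?r\<^sup>2)) *\<^sub>R sgn lam)"
        by (simp add: \<tau>_def T_def prod_eq_iff add.commute)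
      moreover have "gmult br (fst (\<tau> j p)) (?\<gamma> (snd (\<tau> j p))) = gmult br (fst p) (?\<gamma> (snd p))"
      proof -
        have "snd (\<tau> j p) = snd p - of_int j * P" by (simp add: \<tau>_def)
        then show ?thesis by (simp add: \<gamma>P) (simp add: gmult_def \<tau>_def)
      qed
      ultimately show ?thesis by (simp only: Q_def per prod.collapse)
    qed
    have 5: "\<exists>!j. \<tau> j p \<in> E" for p
    proof -
      have "\<tau> j p \<in> E \<longleftrightarrow> 0 \<le> snd (fst p) \<bullet> sgn lam + of_int j * T \<and> snd (fst p) \<bullet> sgn lam + of_int j * T < T" for j
        by (simp add: \<tau>_def E_def D_def fund_domain_def mem_Times_iff inner_add_left ss T_def add.commute)
      then show ?thesis using ex1_int_interval[OF T] by simp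
    qed
    have 6: "\<exists>!j. \<tau> j p \<in> E'" for p
    proof -
      have "\<tau> j p \<in> E' \<longleftrightarrow> 0 \<le> snd p + of_int (- j) * P \<and> snd p + of_int (- j) * P < P" for j
        by (simp add: \<tau>_def E'_def mem_Times_iff)
      moreover obtain j0 where "\<And>j. 0 \<le> snd p + of_int j * P \<and> snd p + of_int j * P < P \<longleftrightarrow> j = j0"
        using ex1_int_interval[OF P, of "snd p"] by metis
      ultimately have "\<tau> j p \<in> E' \<longleftrightarrow> - j = j0" for j by (simp only:)
      then show ?thesis by (intro ex1I[of _ "- j0"]) auto
    qed
    show "set_integrable lborel E Q" "(LINT p:E|lborel. Q p) = (LINT p:E'|lborel. Q p)"
      using integral_fundamental_domains[of \<tau> lborel Q E E', OF 1 2 3 _ 4 _ _ 5 6 nnQ] Em by auto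
  qed
  \<comment> \<open>Over \<open>E\<close> the inner integral runs along the whole line and equals
    \<open>\<psi> g\<close> times the X-ray transform at the coset of \<open>g\<close>, which
    vanishes for almost every \<open>g\<close> in the domain.\<close>
  have "(LINT p:E|lborel. Q p) = (LINT g|lborel. LINT s|lborel. indicator E (g, s) *\<^sub>R Q (g, s))"
    using fd(1) unfolding set_lebesgue_integral_def set_integrable_def lp
    by (rule lborel_pair.integral_fst'[symmetric])
  also have "\<dots> = 0"
  proof (rule integral_eq_zero_AE)
    show "AE g in lborel. (LINT s|lborel. indicator E (g, s) *\<^sub>R Q (g, s)) = 0"
      using AE_quotD[OF xray]
    proof eventually_elim
      case (elim g)
      have "(LINT s|lborel. indicator E (g, s) *\<^sub>R Q (g, s)) =
          indicator D g *\<^sub>R (\<psi> g * (LINT s|lborel. f (gmult br g (?\<gamma> s))))"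
        by (simp add: Q_def E_def indicator_times)
      also have "\<dots> = 0" using elim by (auto simp: D_def indicator_def xray_gcoset[OF H lam])
      finally show ?case .
    qed
  qed
  finally have 0: "(LINT p:E'|lborel. Q p) = 0" using fd(2) by simp
  \<comment> \<open>Over \<open>E'\<close> the integration over \<open>g\<close> is inside, and
    right translation by the curve moves the shift from \<open>f\<close> onto
    \<open>\<psi>\<close>.\<close>
  define R where "R p = f (fst p) * (indicator {0..<P} (snd p) *\<^sub>R \<psi> (gmult br (fst p) (- ?\<gamma> (snd p))))" for p
  have "(LINT p:E'|lborel. Q p) = (LINT s|lborel. LINT g|lborel. indicator E' (g, s) *\<^sub>R Q (g, s))"
    using lborel_pair.integral_snd[of "\<lambda>g s. indicator E' (g, s) *\<^sub>R Q (g, s)"] nnQ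
    unfolding set_lebesgue_integral_def set_integrable_def lp by (simp add: case_prod_beta')
  also have "\<dots> = (LINT s|lborel. LINT g|lborel. R (g, s))"
  proof (rule Bochner_Integration.integral_cong[OF refl])
    fix s :: real
    have [measurable]: "(\<lambda>g. gmult br g (- ?\<gamma> s)) \<in> borel_measurable borel"
      by (intro borel_measurable_continuous_onI continuous_on_gmult[OF H] continuous_intros)
    have "(LINT g|lborel. R (g, s)) = (LINT g|lborel. R (gmult br g (?\<gamma> s), s))"
      by (rule integral_gmult[OF H, symmetric]) (auto simp: R_def)
    also have "\<dots> = (LINT g|lborel. indicator E' (g, s) *\<^sub>R Q (g, s))"
      by (intro Bochner_Integration.integral_cong)
        (auto simp: R_def E'_def Q_def gmult_uminus[OF H] indicator_def)
    finally show "(LINT g|lborel. indicator E' (g, s) *\<^sub>R Q (g, s)) = (LINT g|lborel. R (g, s))" ..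
  qed
  also have "\<dots> = (LINT g|lborel. LINT s|lborel. R (g, s))"
  proof (rule lborel_pair.Fubini_integral)
    have "B \<ge> 0" using B norm_ge_zero order_trans by blast
    have [measurable]: "f \<in> borel_measurable lborel" using f by auto
    have "integrable (lborel \<Otimes>\<^sub>M lborel) (\<lambda>p. (norm (f (fst p)) * B) * indicator {0..<P} (snd p :: real))"
    proof (rule lborel_pair.Fubini_integrable)
      show "integrable lborel (\<lambda>g. LINT s|lborel. norm ((norm (f (fst (g, s))) * B) * indicator {0..<P} (snd (g, s) :: real)))"
        using f \<open>B \<ge> 0\<close> P by (simp add: abs_mult)
    qed (use P in auto)
    then show "integrable (lborel \<Otimes>\<^sub>M lborel) (\<lambda>(g, s). R (g, s))"
    proof (rule Bochner_Integration.integrable_bound)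
      have "R \<in> borel_measurable borel" unfolding R_def by measurable
      then show "(\<lambda>(g, s). R (g, s)) \<in> borel_measurable (lborel \<Otimes>\<^sub>M lborel)"
        by (simp add: lborel_prod)
      show "AE p in lborel \<Otimes>\<^sub>M lborel. norm (case p of (g, s) \<Rightarrow> R (g, s)) \<le>
          norm ((norm (f (fst p)) * B) * indicator {0..<P} (snd p))"
      proof (rule AE_I2)
        fix p :: "('v \<times> 'z) \<times> real"
        show "norm (case p of (g, s) \<Rightarrow> R (g, s)) \<le> norm ((norm (f (fst p)) * B) * indicator {0..<P} (snd p))"
          using B[of "gmult br (fst p) (- ?\<gamma> (snd p))"] \<open>B \<ge> 0\<close>
          by (simp add: case_prod_beta' R_def norm_mult abs_mult indicator_def mult_left_mono)
      qed
    qed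
  qed
  also have "\<dots> = (LINT g|lborel. f g * (LINT s:{0..<2 * pi / norm lam}|lborel. \<psi> (gmult br g (- ?\<gamma> s))))"
    by (simp add: R_def set_lebesgue_integral_def P_def del: mult_scaleR_right)
  finally show ?thesis using 0 by simp
qed

section \<open>Testing the partial Fourier transform against twisted circular means\<close>

lemma central_fourier_integrable:
  fixes f :: "'v::euclidean_space \<times> 'z::euclidean_space \<Rightarrow> complex"
  assumes f: "integrable lborel f"
    and [measurable]: "\<Theta> \<in> borel_measurable borel" and B: "\<And>x. norm (\<Theta> x) \<le> B"
  shows "integrable lborel (\<lambda>x. central_fourier f \<mu> x * \<Theta> x)"
    and "(LINT x|lborel. central_fourier f \<mu> x * \<Theta> x) =
      (LINT g|lborel. f g * (cis (- (\<mu> \<bullet> snd g)) * \<Theta> (fst g)))"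
proof -
  have [measurable]: "(\<lambda>g :: 'v \<times> 'z. cis (- (\<mu> \<bullet> snd g)) * \<Theta> (fst g)) \<in> borel_measurable borel"
  proof (intro borel_measurable_times measurable_compose[OF _ assms(2)])
    show "(\<lambda>g :: 'v \<times> 'z. cis (- (\<mu> \<bullet> snd g))) \<in> borel_measurable borel"
      "(fst :: 'v \<times> 'z \<Rightarrow> 'v) \<in> borel_measurable borel"
      by (intro borel_measurable_continuous_onI continuous_intros)+
  qed
  have i: "integrable (lborel \<Otimes>\<^sub>M lborel) (\<lambda>g. f g * (cis (- (\<mu> \<bullet> snd g)) * \<Theta> (fst g)))"
    unfolding lborel_prod by (rule integrable_mult_bounded[OF f, where B = B]) (use B in \<open>auto simp: norm_mult\<close>)
  have eq: "(LINT u|lborel. f (x, u) * (cis (- (\<mu> \<bullet> snd (x, u))) * \<Theta> (fst (x, u)))) =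
      central_fourier f \<mu> x * \<Theta> x" for x
    by (simp add: central_fourier_def mult.assoc[symmetric])
  show "integrable lborel (\<lambda>x. central_fourier f \<mu> x * \<Theta> x)"
    using lborel_pair.integrable_fst'[OF i] unfolding eq .
  show "(LINT x|lborel. central_fourier f \<mu> x * \<Theta> x) =
      (LINT g|lborel. f g * (cis (- (\<mu> \<bullet> snd g)) * \<Theta> (fst g)))"
    using lborel_pair.integral_fst'[OF i] unfolding eq by (simp only: lborel_prod)
qed

lemma integrable_central_fourier:
  assumes "integrable lborel f"
  shows "integrable lborel (central_fourier f \<mu>)"
  using central_fourier_integrable(1)[OF assms, of "\<lambda>_. 1" 1 \<mu>] by simp

text \<open>Duality with \<open>\<psi> (x, u) = \<phi> x * cis (- (\<mu> \<bullet> u))\<close>; the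
  condition on \<open>\<mu>\<close> makes this periodic under the central lattice. In the phase,
  \<open>of_int k * norm lam * s\<close> stems from the central part of the curve and the bracket
  term from the group law.\<close>

lemma xray_zero_central_fourier:
  fixes br :: "('v::euclidean_space, 'z::euclidean_space) bracket"
    and f :: "'v \<times> 'z \<Rightarrow> complex" and \<phi> :: "'v \<Rightarrow> complex" and k :: int
  assumes H: "H_type br" and lam: "lam \<noteq> 0" and \<nu>: "norm \<nu> = 1"
    and f: "integrable lborel f"
    and xray: "AE C in quot br lam. xray br \<nu> lam f C = 0"
    and \<mu>: "\<mu> \<bullet> sgn lam = 2 * (norm lam)\<^sup>2 * of_int k"
    and c\<phi>: "continuous_on UNIV \<phi>" and B: "\<And>x. norm (\<phi> x) \<le> B"
    and \<Theta>: "\<And>x. (LINT s:{0..<2 * pi / norm lam}|lborel. \<phi> (x - fst (gcurve br \<nu> lam s)) *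
        cis (of_int k * norm lam * s + \<mu> \<bullet> hbr br x (fst (gcurve br \<nu> lam s)) / 2)) = \<Theta> x"
    and \<Theta>m: "\<Theta> \<in> borel_measurable borel"
  shows "(LINT x|lborel. central_fourier f \<mu> x * \<Theta> x) = 0"
proof -
  let ?r = "norm lam" and ?\<gamma> = "gcurve br \<nu> lam"
  have r: "?r > 0" using lam by simp
  define \<psi> :: "'v \<times> 'z \<Rightarrow> complex" where "\<psi> g = \<phi> (fst g) * cis (- (\<mu> \<bullet> snd g))" for g
  have \<psi>m: "\<psi> \<in> borel_measurable borel"
    unfolding \<psi>_def by (intro borel_measurable_continuous_onI continuous_intros continuous_on_compose2[OF c\<phi>]) auto
  have per: "\<psi> (x, u + (of_int j * (pi / ?r\<^sup>2)) *\<^sub>R sgn lam) = \<psi> (x, u)" for j x u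
  proof -
    have "\<mu> \<bullet> (u + (of_int j * (pi / ?r\<^sup>2)) *\<^sub>R sgn lam) = \<mu> \<bullet> u + 2 * pi * of_int (j * k)"
      using r by (simp add: inner_add_right \<mu>)
    then have "cis (- (\<mu> \<bullet> (u + (of_int j * (pi / ?r\<^sup>2)) *\<^sub>R sgn lam))) = cis (- (\<mu> \<bullet> u)) * cis (2 * pi * of_int (- (j * k)))"
      by (simp add: cis_mult)
    also have "cis (2 * pi * of_int (- (j * k))) = 1" by (rule cis_multiple_2pi) simp
    finally show ?thesis by (simp only: \<psi>_def fst_conv snd_conv mult_1_right)
  qed
  have eq: "\<psi> (gmult br g (- ?\<gamma> s)) = cis (- (\<mu> \<bullet> snd g)) *
      (\<phi> (fst g - fst (?\<gamma> s)) * cis (of_int k * ?r * s + \<mu> \<bullet> hbr br (fst g) (fst (?\<gamma> s)) / 2))" for g s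
  proof -
    have "\<mu> \<bullet> snd (?\<gamma> s) = of_int k * ?r * s"
      using r by (simp add: gcurve_def \<mu> power2_eq_square)
    then have "- (\<mu> \<bullet> snd (gmult br g (- ?\<gamma> s))) =
        - (\<mu> \<bullet> snd g) + (of_int k * ?r * s + \<mu> \<bullet> hbr br (fst g) (fst (?\<gamma> s)) / 2)"
      by (simp add: gmult_def bilinear_rneg[OF H_type_bilinear[OF H]] inner_diff_right)
    then have "cis (- (\<mu> \<bullet> snd (gmult br g (- ?\<gamma> s)))) =
        cis (- (\<mu> \<bullet> snd g)) * cis (of_int k * ?r * s + \<mu> \<bullet> hbr br (fst g) (fst (?\<gamma> s)) / 2)"
      by (simp only: cis_mult)
    then show ?thesis by (simp add: \<psi>_def) (simp add: gmult_def)
  qed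
  have "B \<ge> 0" using B norm_ge_zero order_trans by blast
  have "norm (\<Theta> x) \<le> B * (2 * pi / ?r)" for x
  proof -
    let ?g = "\<lambda>s. \<phi> (x - fst (?\<gamma> s)) * cis (of_int k * ?r * s + \<mu> \<bullet> hbr br x (fst (?\<gamma> s)) / 2)"
    have "norm (\<Theta> x) \<le> (LINT s|lborel. norm (indicator {0..<2 * pi / ?r} s *\<^sub>R ?g s))"
      unfolding \<Theta>[symmetric] set_lebesgue_integral_def by (rule integral_norm_bound)
    also have "\<dots> \<le> (LINT s|lborel. indicator {0..<2 * pi / ?r} s * B)"
    proof (rule integral_mono')
      show "integrable lborel (\<lambda>s. indicator {0..<2 * pi / ?r} s * B)" using r by simp
    qed (use B \<open>B \<ge> 0\<close> in \<open>auto simp: norm_mult indicator_def\<close>)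
    also have "\<dots> = B * (2 * pi / ?r)" using r by simp
    finally show ?thesis .
  qed
  note \<Theta>B = this
  have "(LINT x|lborel. central_fourier f \<mu> x * \<Theta> x) =
      (LINT g|lborel. f g * (cis (- (\<mu> \<bullet> snd g)) * \<Theta> (fst g)))"
    by (rule central_fourier_integrable(2)[OF f \<Theta>m \<Theta>B])
  also have "\<dots> = (LINT g|lborel. f g * (LINT s:{0..<2 * pi / ?r}|lborel. \<psi> (gmult br g (- ?\<gamma> s))))"
    unfolding eq by (simp add: \<Theta>)
  also have "\<dots> = 0"
    by (rule xray_zero_duality[OF H lam \<nu> f xray \<psi>m _ per, where B = B])
      (use B in \<open>simp add: \<psi>_def norm_mult\<close>)
  finally show ?thesis .
qed

section \<open>Characters orthogonal to the charge\<close>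

text \<open>
  Since \<open>\<mu>\<close> is orthogonal to \<open>lam\<close>, \<open>Jmap br \<mu>\<close> maps the plane of the circle to its orthogonal
  complement. Multiplication by \<open>cis (\<beta> x (p x) / 2)\<close>, \<open>p\<close> being the projection onto that plane,
  therefore removes the twist, and what remains is an ordinary convolution with a circle.
\<close>

lemma central_fourier_zero_orthogonal:
  fixes br :: "('v::euclidean_space, 'z::euclidean_space) bracket"
  assumes H: "H_type br" and lam: "lam \<noteq> 0" and \<nu>: "norm \<nu> = 1"
    and f: "integrable lborel f"
    and xray: "AE C in quot br lam. xray br \<nu> lam f C = 0"
    and \<mu>: "\<mu> \<bullet> lam = 0"
  shows "AE x in lborel. central_fourier f \<mu> x = 0"
proof -
  let ?r = "norm lam"
  have r: "?r > 0" using lam by simp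
  define P where "P = 2 * pi / ?r"
  have P: "P > 0" using r by (simp add: P_def)
  obtain e where e: "norm e = 1" "e \<bullet> \<nu> = 0" and Je: "Jmap br lam e = ?r *\<^sub>R \<nu>"
    and \<gamma>: "\<And>s. gcurve br \<nu> lam s =
      ((1 / ?r) *\<^sub>R (cos (?r * s) *\<^sub>R e + sin (?r * s) *\<^sub>R \<nu>), (s / (2 * ?r)) *\<^sub>R sgn lam)"
    by (rule gcurve_circle[OF H lam \<nu>]) blast
  define c where "c s = fst (gcurve br \<nu> lam s)" for s
  define p where "p x = (x \<bullet> e) *\<^sub>R e + (x \<bullet> \<nu>) *\<^sub>R \<nu>" for x
  have c: "c s = (1 / ?r) *\<^sub>R (cos (?r * s) *\<^sub>R e + sin (?r * s) *\<^sub>R \<nu>)" for s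
    by (simp add: c_def \<gamma>)
  have cc: "continuous_on UNIV c" unfolding c using r by (intro continuous_intros) auto
  then have [measurable]: "c \<in> borel_measurable borel" by (rule borel_measurable_continuous_onI)
  have cp: "continuous_on UNIV p" unfolding p_def by (intro continuous_intros)
  note b = H_type_bilinear[OF H]
  define \<beta> where "\<beta> x y = \<mu> \<bullet> hbr br x y" for x y
  \<comment> \<open>The form \<open>\<beta>\<close> vanishes on the plane of the circle:
    \<open>\<beta> e \<nu>\<close> is \<open>Jmap br \<mu> e \<bullet> \<nu>\<close>, and
    \<open>\<nu>\<close> is parallel to \<open>Jmap br lam e\<close> with \<open>\<mu>\<close>
    orthogonal to \<open>lam\<close>.\<close>
  have \<beta>0: "\<beta> e \<nu> = 0" "\<beta> \<nu> e = 0" "\<beta> x x = 0" for x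
  proof -
    have "Jmap br \<mu> e \<bullet> (?r *\<^sub>R \<nu>) = 0" unfolding Je[symmetric] by (rule Jmap_orthogonal[OF H \<mu>])
    then show "\<beta> e \<nu> = 0" using r by (simp add: \<beta>_def Jmap_inner[OF H])
    then show "\<beta> \<nu> e = 0" using hbr_antisym[OF H, of \<nu> e] by (simp add: \<beta>_def)
    show "\<beta> x x = 0" by (simp add: \<beta>_def hbr_self[OF H])
  qed
  have \<beta>l: "\<beta> (x + y) z = \<beta> x z + \<beta> y z" "\<beta> (x - y) z = \<beta> x z - \<beta> y z" "\<beta> (t *\<^sub>R x) z = t * \<beta> x z"
    and \<beta>r: "\<beta> z (x + y) = \<beta> z x + \<beta> z y" "\<beta> z (x - y) = \<beta> z x - \<beta> z y" "\<beta> z (t *\<^sub>R x) = t * \<beta> z x" for x y z t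
    by (simp_all add: \<beta>_def bilinear_ladd[OF b] bilinear_lsub[OF b] bilinear_lmul[OF b]
        bilinear_radd[OF b] bilinear_rsub[OF b] bilinear_rmul[OF b] inner_add_right inner_diff_right)
  have ee: "e \<bullet> e = 1" "\<nu> \<bullet> \<nu> = 1" "\<nu> \<bullet> e = 0" using e \<nu> by (auto simp: norm_eq_1 inner_commute)
  have pc: "p (x - c s) = p x - c s" for x s
    unfolding p_def c by (simp add: inner_simps ee e(2) algebra_simps)
  have \<beta>c: "\<beta> (x - c s) (p (x - c s)) = \<beta> x (p x) - \<beta> x (c s)" for x s
  proof -
    have "\<beta> (c s) (p x) = 0" unfolding p_def c by (simp add: \<beta>l \<beta>r \<beta>0)
    then show ?thesis unfolding pc by (simp add: \<beta>l \<beta>r \<beta>0)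
  qed
  define h where "h x = central_fourier f \<mu> x * cis (\<beta> x (p x) / 2)" for x
  have c\<beta>: "continuous_on UNIV (\<lambda>x. \<beta> x (p x))"
    unfolding \<beta>_def by (intro continuous_intros continuous_on_hbr H cp)
  then have [measurable]: "(\<lambda>x. \<beta> x (p x)) \<in> borel_measurable borel" by (rule borel_measurable_continuous_onI)
  have cm: "(\<lambda>x. cis (\<beta> x (p x) / 2)) \<in> borel_measurable borel"
    by (intro borel_measurable_continuous_onI continuous_intros c\<beta>) auto
  have h: "integrable lborel h"
    unfolding h_def by (rule central_fourier_integrable(1)[OF f cm, where B = 1]) auto
  define W where "W \<xi> = (LINT s:{0..<P}|lborel. cis (- (\<xi> \<bullet> c s)))" for \<xi>
  \<comment> \<open>Convolution theorem: for a character times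
    \<open>cis (\<beta> x (p x) / 2)\<close> the twisted mean multiplies the test function by the
    scalar \<open>W \<xi>\<close>, the Fourier transform of the circle.\<close>
  have prod: "(LINT x|lborel. h x * cis (\<xi> \<bullet> x)) * W \<xi> = 0" for \<xi>
  proof -
    define \<phi> where "\<phi> x = cis (\<xi> \<bullet> x + \<beta> x (p x) / 2)" for x
    have cphi: "continuous_on UNIV \<phi>" unfolding \<phi>_def by (intro continuous_intros c\<beta>) auto
    have eq: "\<phi> (x - c s) * cis (of_int 0 * ?r * s + \<mu> \<bullet> hbr br x (c s) / 2) =
        cis (\<beta> x (p x) / 2) * cis (\<xi> \<bullet> x) * cis (- (\<xi> \<bullet> c s))" for x s
      unfolding \<beta>_def[symmetric] \<phi>_def cis_mult \<beta>c by (simp add: inner_diff_right diff_divide_distrib algebra_simps)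
    have "(LINT x|lborel. central_fourier f \<mu> x * (cis (\<beta> x (p x) / 2) * cis (\<xi> \<bullet> x) * W \<xi>)) = 0"
    proof (rule xray_zero_central_fourier[OF H lam \<nu> f xray _ cphi])
      show "\<mu> \<bullet> sgn lam = 2 * (norm lam)\<^sup>2 * of_int 0" using \<mu> by (simp add: sgn_div_norm)
      show "norm (\<phi> x) \<le> 1" for x by (simp add: \<phi>_def)
      show "(LINT s:{0..<2 * pi / norm lam}|lborel. \<phi> (x - fst (gcurve br \<nu> lam s)) *
        cis (of_int 0 * norm lam * s + \<mu> \<bullet> hbr br x (fst (gcurve br \<nu> lam s)) / 2)) =
        cis (\<beta> x (p x) / 2) * cis (\<xi> \<bullet> x) * W \<xi>" for x
        unfolding c_def[symmetric] eq W_def P_def by simp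
      show "(\<lambda>x. cis (\<beta> x (p x) / 2) * cis (\<xi> \<bullet> x) * W \<xi>) \<in> borel_measurable borel"
        using cm by measurable
    qed
    moreover have "central_fourier f \<mu> x * (cis (\<beta> x (p x) / 2) * cis (\<xi> \<bullet> x) * W \<xi>) = h x * cis (\<xi> \<bullet> x) * W \<xi>" for x
      by (simp add: h_def mult_ac)
    ultimately show ?thesis by simp
  qed
  have "(LINT x|lborel. h x * cis (\<xi> \<bullet> x)) = 0" for \<xi>
  proof (rule ccontr)
    \<comment> \<open>If \<open>hF \<xi>\<close> were nonzero, \<open>hF\<close> would be nonzero at
      \<open>\<xi> - t *\<^sub>R \<xi>\<close> for small \<open>t\<close>, so \<open>W\<close> would
      vanish there. The identity theorem carries this to \<open>t = 1\<close>, which contradicts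
      \<open>W 0 = P > 0\<close>.\<close>
    define hF where "hF \<xi> = (LINT x|lborel. h x * cis (\<xi> \<bullet> x))" for \<xi>
    assume "(LINT x|lborel. h x * cis (\<xi> \<bullet> x)) \<noteq> 0"
    then have n: "hF \<xi> \<noteq> 0" by (simp add: hF_def)
    have "continuous_on UNIV (\<lambda>t. hF (\<xi> - t *\<^sub>R \<xi>))"
      unfolding hF_def by (intro continuous_on_compose2[OF continuous_on_fourier[OF h]] continuous_intros) auto
    then have "isCont (\<lambda>t. hF (\<xi> - t *\<^sub>R \<xi>)) 0" by (simp add: continuous_on_eq_continuous_at)
    then obtain d where d: "d > 0" "\<And>t. \<bar>t\<bar> < d \<Longrightarrow> hF (\<xi> - t *\<^sub>R \<xi>) \<noteq> 0"
      using continuous_at_avoid[of 0 "\<lambda>t. hF (\<xi> - t *\<^sub>R \<xi>)" 0] n by (auto simp: dist_real_def)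
    define g where "g s = indicator {0..<P} s *\<^sub>R cis (- (\<xi> \<bullet> c s))" for s
    have g: "W (\<xi> - t *\<^sub>R \<xi>) = (LINT s|lborel. g s * cis (- (t * (- (\<xi> \<bullet> c s)))))" for t
      by (simp add: W_def g_def set_lebesgue_integral_def cis_mult inner_diff_left algebra_simps)
    have "(LINT s|lborel. g s * cis (- (1 * (- (\<xi> \<bullet> c s))))) = 0"
    proof (rule cis_integral_zero_near_imp_zero[OF _ _ _ d(1)])
      have [measurable]: "(\<lambda>s. cis (- (\<xi> \<bullet> c s))) \<in> borel_measurable borel"
        by (intro borel_measurable_continuous_onI continuous_intros cc)
      show gm: "g \<in> borel_measurable lborel" unfolding g_def by measurable
      show qm: "(\<lambda>s. - (\<xi> \<bullet> c s)) \<in> borel_measurable lborel" by measurable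
      show "integrable lborel (\<lambda>s. exp (a * \<bar>- (\<xi> \<bullet> c s)\<bar>) * norm (g s))" for a
      proof (rule Bochner_Integration.integrable_bound)
        show "integrable lborel (\<lambda>s. indicator {0..<P} s * exp (\<bar>a\<bar> * (norm \<xi> * (2 / ?r))))"
          using P by simp
        have nc: "norm (c s) \<le> 2 / ?r" for s
        proof -
          have "norm (cos (?r * s) *\<^sub>R e + sin (?r * s) *\<^sub>R \<nu>) \<le> 1 + 1"
            by (rule order_trans[OF norm_triangle_ineq add_mono]) (use e \<nu> in auto)
          then show ?thesis using r by (simp add: c divide_right_mono)
        qed
        have "exp (a * \<bar>\<xi> \<bullet> c s\<bar>) \<le> exp (\<bar>a\<bar> * (norm \<xi> * (2 / ?r)))" for s
        proof -
          have "a * \<bar>\<xi> \<bullet> c s\<bar> \<le> \<bar>a\<bar> * (norm \<xi> * norm (c s))"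
            by (rule mult_mono) (auto simp: Cauchy_Schwarz_ineq2)
          also have "\<dots> \<le> \<bar>a\<bar> * (norm \<xi> * (2 / ?r))" by (intro mult_left_mono nc) auto
          finally show ?thesis by simp
        qed
        then show "AE s in lborel. norm (exp (a * \<bar>- (\<xi> \<bullet> c s)\<bar>) * norm (g s)) \<le>
            norm (indicator {0..<P} s * exp (\<bar>a\<bar> * (norm \<xi> * (2 / ?r))))"
          by (intro AE_I2) (simp add: g_def indicator_def)
      qed (use gm qm in measurable)
      show "(LINT s|lborel. g s * cis (- (t * (- (\<xi> \<bullet> c s))))) = 0" if "\<bar>t\<bar> < d" for t
        using prod[of "\<xi> - t *\<^sub>R \<xi>"] d(2)[OF that] by (simp add: g hF_def)
    qed
    then have "W 0 = 0" using g[of 1] by simp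
    then show False using P by (simp add: W_def set_lebesgue_integral_def)
  qed
  from fourier_unique[OF h this] show ?thesis by (simp add: h_def)
qed

section \<open>Characters parallel to the charge\<close>

text \<open>Up to sign, \<open>twist_coeff 0 (n + 1)\<close> is the value at 1 of the Laguerre polynomial \<open>L\<close> with indices \<open>n\<close> and 1.\<close>

definition twist_coeff :: "nat \<Rightarrow> nat \<Rightarrow> complex" where
  "twist_coeff i b = (\<Sum>j\<in>{i<..b}. of_nat (b choose j) * (- 1) ^ j / fact (j - i - 1))"

lemma laguerre_sum_nonzero:
  "(\<Sum>l\<le>n. of_nat (Suc n choose Suc l) * (- 1) ^ l / fact l) \<noteq> (0 :: real)"
proof
  assume 0: "(\<Sum>l\<le>n. of_nat (Suc n choose Suc l) * (- 1) ^ l / fact l) = (0 :: real)"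
  \<comment> \<open>Multiplied by \<open>fact n\<close>, the sum is an integer congruent to its last term \<open>\<plusminus> 1\<close> modulo \<open>n\<close>.\<close>
  define A :: "nat \<Rightarrow> int" where "A l = of_nat (Suc n choose Suc l) * (- 1) ^ l * (fact n div fact l)" for l
  have A: "real_of_int (A l) = fact n * (of_nat (Suc n choose Suc l) * (- 1) ^ l / fact l)" if "l \<le> n" for l
  proof -
    have "(fact l :: int) dvd fact n" using that by (rule fact_dvd)
    then have "real_of_int (fact n div fact l) = fact n / fact l"
      by (simp add: real_of_int_div)
    then show ?thesis by (simp add: A_def)
  qed
  have "real_of_int (\<Sum>l\<le>n. A l) = (\<Sum>l\<le>n. fact n * (of_nat (Suc n choose Suc l) * (- 1) ^ l / fact l))"
    unfolding of_int_sum by (intro sum.cong refl A) simp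
  also have "\<dots> = 0" by (simp only: sum_distrib_left[symmetric] 0 mult_zero_right)
  finally have s0: "(\<Sum>l\<le>n. A l) = 0" by (simp only: of_int_eq_0_iff)
  have An: "A n = (- 1) ^ n" by (simp add: A_def)
  \<comment> \<open>A congruence modulo \<open>n\<close> excludes the value 0 only for
    \<open>n \<ge> 2\<close>; the two smaller sums are evaluated directly.\<close>
  consider "n = 0" | "n = 1" | "n \<ge> 2" by linarith
  then show False
  proof cases
    case 1
    then show False using s0 An by simp
  next
    case 2
    then show False using 0 by simp
  next
    case 3
    have "int n dvd A l" if "l < n" for l
    proof -
      obtain m where m: "n = Suc m" using 3 by (cases n) auto
      then have "(fact l :: int) dvd fact m" using that by (intro fact_dvd) simp
      then obtain q where "(fact m :: int) = fact l * q" by (elim dvdE)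
      then have "(fact n :: int) div fact l = int n * q" by (simp add: m field_simps)
      then show ?thesis unfolding A_def by simp
    qed
    then have "int n dvd (\<Sum>l<n. A l)" by (intro dvd_sum) auto
    moreover have "(\<Sum>l\<le>n. A l) = (\<Sum>l<n. A l) + A n" by (simp add: lessThan_Suc_atMost[symmetric])
    ultimately have "int n dvd (- 1) ^ n"
      using s0 An by (metis add.commute add.inverse_inverse dvd_minus_iff eq_neg_iff_add_eq_0)
    then have "int n dvd 1" by (cases "even n") auto
    then show False using 3 by simp
  qed
qed

lemma twist_coeff_nonzero: "twist_coeff 0 (Suc n) \<noteq> 0"
proof -
  have "twist_coeff 0 (Suc n) = (\<Sum>l\<le>n. of_nat (Suc n choose Suc l) * (- 1) ^ Suc l / fact l)"
    unfolding twist_coeff_def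
    by (rule sum.reindex_bij_witness[of _ Suc "\<lambda>j. j - 1"]) auto
  also have "\<dots> = - of_real (\<Sum>l\<le>n. of_nat (Suc n choose Suc l) * (- 1) ^ l / fact l)"
    by (simp add: sum_negf[symmetric])
  finally show ?thesis using laguerre_sum_nonzero[of n] by (simp del: of_real_sum)
qed

lemma integral_cis_period:
  fixes r :: real and n :: int
  assumes r: "r > 0"
  shows "(LINT s:{0..<2 * pi / r}|lborel. cis (of_int n * (r * s))) = (if n = 0 then 2 * pi / r else 0)"
proof (cases "n = 0")
  case True
  then show ?thesis using r by (simp add: set_lebesgue_integral_def scaleR_conv_of_real)
next
  case False
  define F where "F s = cis (of_int n * (r * s)) / (\<i> * of_int n * of_real r)" for s
  have "has_bochner_integral lborel (\<lambda>s. indicator {0..2 * pi / r} s *\<^sub>R cis (of_int n * (r * s))) (F (2 * pi / r) - F 0)"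
  proof (rule has_bochner_integral_FTC_Icc)
    show "0 \<le> 2 * pi / r" using r by simp
    show "continuous_on {0..2 * pi / r} (\<lambda>s. cis (of_int n * (r * s)))" by (intro continuous_intros)
    fix s :: real
    define K where "K = \<i> * of_int n * of_real r"
    have K: "K \<noteq> 0" using False r by (simp add: K_def)
    have eK: "cis (of_int n * (r * s)) = exp (K * of_real s)" for s
      by (simp add: cis_conv_exp K_def mult_ac)
    have "((\<lambda>z. exp (K * z) / K) has_field_derivative exp (K * of_real s)) (at (of_real s))"
      using K by (auto intro!: derivative_eq_intros)
    from has_vector_derivative_real_field[OF this]
    show "(F has_vector_derivative cis (of_int n * (r * s))) (at s within {0..2 * pi / r})"
      unfolding F_def eK K_def[symmetric] .
  qed
  moreover have "F (2 * pi / r) - F 0 = 0"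
    using r cis_multiple_2pi[of "of_int n"] by (simp add: F_def mult.commute)
  ultimately have "(LINT s|lborel. indicator {0..2 * pi / r} s *\<^sub>R cis (of_int n * (r * s))) = 0"
    by (simp add: has_bochner_integral_integral_eq)
  moreover have "(LINT s|lborel. indicator {0..2 * pi / r} s *\<^sub>R cis (of_int n * (r * s))) =
      (LINT s|lborel. indicator {0..<2 * pi / r} s *\<^sub>R cis (of_int n * (r * s)))"
  proof (rule integral_cong_AE)
    show "AE s in lborel. indicator {0..2 * pi / r} s *\<^sub>R cis (of_int n * (r * s)) =
        indicator {0..<2 * pi / r} s *\<^sub>R cis (of_int n * (r * s))"
      using AE_lborel_singleton[of "2 * pi / r"] by eventually_elim (auto simp: indicator_def)
    have [measurable]: "(\<lambda>s. cis (of_int n * (r * s))) \<in> borel_measurable borel"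
      by (intro borel_measurable_continuous_onI continuous_intros)
    show "(\<lambda>s. indicator {0..2 * pi / r} s *\<^sub>R cis (of_int n * (r * s))) \<in> borel_measurable lborel"
      "(\<lambda>s. indicator {0..<2 * pi / r} s *\<^sub>R cis (of_int n * (r * s))) \<in> borel_measurable lborel"
      by measurable
  qed
  ultimately show ?thesis using False by (simp add: set_lebesgue_integral_def)
qed

text \<open>Expanding the exponential, orthogonality of characters leaves only the term of order
  \<open>j - p\<close>, which exists precisely for \<open>p \<le> j\<close>.\<close>

lemma integral_circle_exp:
  fixes v :: complex
  assumes r: "r > 0"
  shows "(LINT s:{0..<2 * pi / r}|lborel. cis (r * s) ^ p * cnj (cis (r * s)) ^ j * exp (v * cis (r * s))) =
      of_real (2 * pi / r) * (if p \<le> j then v ^ (j - p) / fact (j - p) else 0)"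
proof -
  define P where "P = 2 * pi / r"
  have P: "P > 0" using r by (simp add: P_def)
  define g where "g l s = indicator {0..<P} s *\<^sub>R (cis (r * s) ^ p * cnj (cis (r * s)) ^ j * ((v * cis (r * s)) ^ l /\<^sub>R fact l))" for l :: nat and s
  have [measurable]: "g l \<in> borel_measurable lborel" for l
  proof -
    have [measurable]: "(\<lambda>s. cis (r * s) ^ p * cnj (cis (r * s)) ^ j * ((v * cis (r * s)) ^ l /\<^sub>R fact l)) \<in> borel_measurable borel"
      by (intro borel_measurable_continuous_onI continuous_intros)
    show ?thesis unfolding g_def by measurable
  qed
  have ng: "norm (g l s) = indicator {0..<P} s * (norm v ^ l /\<^sub>R fact l)" for l s
    by (simp add: g_def norm_mult norm_power divide_inverse)
  have ig: "integrable lborel (g l)" for l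
  proof (rule Bochner_Integration.integrable_bound)
    show "integrable lborel (\<lambda>s. indicator {0..<P} s * (norm v ^ l /\<^sub>R fact l))" using P by simp
  qed (auto simp: ng)
  have int: "integral\<^sup>L lborel (g l) = (v ^ l /\<^sub>R fact l) * (if int p + int l = int j then of_real P else 0)" for l
  proof -
    have "cis (r * s) ^ p * cnj (cis (r * s)) ^ j * ((v * cis (r * s)) ^ l /\<^sub>R fact l) =
        (v ^ l /\<^sub>R fact l) * cis (of_int (int p + int l - int j) * (r * s))" for s
    proof -
      have "cis (r * s) ^ p * cnj (cis (r * s)) ^ j * cis (r * s) ^ l = cis (of_int (int p + int l - int j) * (r * s))"
        unfolding cis_cnj Complex.DeMoivre cis_mult by (rule arg_cong[of _ _ cis]) (simp add: algebra_simps)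
      then show ?thesis by (simp add: power_mult_distrib mult_ac)
    qed
    then have "g l = (\<lambda>s. indicator {0..<P} s *\<^sub>R ((v ^ l /\<^sub>R fact l) * cis (of_int (int p + int l - int j) * (r * s))))"
      by (intro ext) (simp only: g_def)
    then have "integral\<^sup>L lborel (g l) = (LINT s:{0..<P}|lborel. (v ^ l /\<^sub>R fact l) * cis (of_int (int p + int l - int j) * (r * s)))"
      by (simp only: set_lebesgue_integral_def)
    also have "\<dots> = (v ^ l /\<^sub>R fact l) * (LINT s:{0..<P}|lborel. cis (of_int (int p + int l - int j) * (r * s)))"
      by (rule set_integral_mult_right)
    also have "\<dots> = (v ^ l /\<^sub>R fact l) * (if int p + int l = int j then of_real P else 0)"
      unfolding P_def integral_cis_period[OF r] by simp
    finally show ?thesis .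
  qed
  have "(\<lambda>l. integral\<^sup>L lborel (g l)) sums (LINT s|lborel. (\<Sum>l. g l s))"
  proof (rule sums_integral[OF ig])
    have "summable (\<lambda>l. norm v ^ l /\<^sub>R fact l)" using exp_converges[of "norm v"] by (simp add: sums_iff)
    then show "AE s in lborel. summable (\<lambda>l. norm (g l s))" "summable (\<lambda>l. LINT s|lborel. norm (g l s))"
      unfolding ng using P by (auto intro!: summable_mult)
  qed
  moreover have "(\<Sum>l. g l s) = indicator {0..<P} s *\<^sub>R (cis (r * s) ^ p * cnj (cis (r * s)) ^ j * exp (v * cis (r * s)))" for s
    unfolding g_def by (intro sums_unique[symmetric] sums_scaleR_right sums_mult exp_converges)
  moreover have "(\<lambda>l. integral\<^sup>L lborel (g l)) sums (of_real P * (if p \<le> j then v ^ (j - p) / fact (j - p) else 0))"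
  proof (cases "p \<le> j")
    case True
    have "(\<lambda>l. integral\<^sup>L lborel (g l)) = (\<lambda>l. if l = j - p then of_real P * v ^ l / fact l else 0)"
    proof
      fix l
      have "int p + int l = int j \<longleftrightarrow> l = j - p" using True by auto
      then show "integral\<^sup>L lborel (g l) = (if l = j - p then of_real P * v ^ l / fact l else 0)"
        unfolding int by (simp add: scaleR_conv_of_real divide_inverse)
    qed
    then show ?thesis
      using True sums_single[of "j - p" "\<lambda>l. of_real P * v ^ l / fact l"] by simp
  next
    case False
    then show ?thesis unfolding int by (simp add: sums_zero)
  qed
  ultimately show ?thesis
    by (simp add: sums_unique2 set_lebesgue_integral_def P_def)
qed

text \<open>Both powers are expanded binomially and each term is integrated over the circle. For
  \<open>b \<le> i\<close> the coefficient \<open>twist_coeff i b\<close> is an empty sum, so the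
  truncated subtraction in \<open>b - i - 1\<close> is harmless.\<close>

lemma integral_twisted_circle:
  fixes w :: complex
  assumes r: "r > 0"
  shows "(LINT s:{0..<2 * pi / r}|lborel. (w - cis (r * s)) ^ a * cnj (w - cis (r * s)) ^ b *
        (exp (cnj w * cis (r * s)) * cis (r * s))) =
      of_real (2 * pi / r) * (\<Sum>i\<le>a. of_nat (a choose i) * (- 1) ^ i * twist_coeff i b * w ^ (a - i) * cnj w ^ (b - i - 1))"
proof -
  define P where "P = 2 * pi / r"
  have P: "P > 0" using r by (simp add: P_def)
  define J where "J p j = (\<lambda>s. indicator {0..<P} s *\<^sub>R (cis (r * s) ^ p * cnj (cis (r * s)) ^ j * exp (cnj w * cis (r * s))))" for p j :: nat
  have iJ: "integrable lborel (J p j)" for p j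
  proof (rule Bochner_Integration.integrable_bound)
    show "integrable lborel (\<lambda>s. indicator {0..<P} s * exp (norm w))" using P by simp
    have [measurable]: "(\<lambda>s. cis (r * s) ^ p * cnj (cis (r * s)) ^ j * exp (cnj w * cis (r * s))) \<in> borel_measurable borel"
      by (intro borel_measurable_continuous_onI continuous_intros)
    show "J p j \<in> borel_measurable lborel" unfolding J_def by measurable
    have "norm (exp (cnj w * cis (r * s))) \<le> exp (norm w)" for s
      using norm_exp[of "cnj w * cis (r * s)"] by (simp add: norm_mult)
    then show "AE s in lborel. norm (J p j s) \<le> norm (indicator {0..<P} s * exp (norm w))"
      by (intro AE_I2) (simp add: J_def norm_mult norm_power indicator_def)
  qed
  define C where "C i j = of_nat (a choose i) * (- 1) ^ i * w ^ (a - i) * (of_nat (b choose j) * (- 1) ^ j * cnj w ^ (b - j))" for i j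
  have binom: "(x - y) ^ n = (\<Sum>k\<le>n. of_nat (n choose k) * (- 1) ^ k * x ^ (n - k) * y ^ k)" for x y :: complex and n
    using binomial_ring[of "- y" x n] by (simp add: power_minus[of y] mult_ac)
  have alg: "x *\<^sub>R ((A1 * A2 * A3 * T) * (B1 * B2 * B3 * X) * (E * Y)) = A1 * A2 * A3 * (B1 * B2 * B3) * (x *\<^sub>R (Y * T * X * E))"
    for x :: real and A1 A2 A3 B1 B2 B3 T X Y E :: complex
    by simp
  have sp: "(\<Sum>i\<le>a. A i) * (\<Sum>j\<le>b. B j) * Z = (\<Sum>i\<le>a. \<Sum>j\<le>b. A i * B j * Z)" for A B :: "nat \<Rightarrow> complex" and Z
    by (subst sum_product) (simp only: sum_distrib_right)
  have "indicator {0..<P} s *\<^sub>R ((w - cis (r * s)) ^ a * cnj (w - cis (r * s)) ^ b * (exp (cnj w * cis (r * s)) * cis (r * s))) =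
      (\<Sum>i\<le>a. \<Sum>j\<le>b. C i j * J (Suc i) j s)" for s
  proof -
    have e: "(w - cis (r * s)) ^ a * cnj (w - cis (r * s)) ^ b * (exp (cnj w * cis (r * s)) * cis (r * s)) =
        (\<Sum>i\<le>a. \<Sum>j\<le>b. (of_nat (a choose i) * (- 1) ^ i * w ^ (a - i) * cis (r * s) ^ i) *
          (of_nat (b choose j) * (- 1) ^ j * cnj w ^ (b - j) * cnj (cis (r * s)) ^ j) * (exp (cnj w * cis (r * s)) * cis (r * s)))"
      unfolding complex_cnj_diff binom[of w "cis (r * s)" a] binom[of "cnj w" "cnj (cis (r * s))" b] by (rule sp)
    show ?thesis
      unfolding e scaleR_sum_right by (rule sum.cong[OF refl], rule sum.cong[OF refl]) (simp only: C_def J_def power_Suc alg)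
  qed
  then have "(LINT s:{0..<P}|lborel. (w - cis (r * s)) ^ a * cnj (w - cis (r * s)) ^ b *
        (exp (cnj w * cis (r * s)) * cis (r * s))) = (LINT s|lborel. (\<Sum>i\<le>a. \<Sum>j\<le>b. C i j * J (Suc i) j s))"
    unfolding set_lebesgue_integral_def by (rule Bochner_Integration.integral_cong[OF refl])
  also have "\<dots> = (\<Sum>i\<le>a. \<Sum>j\<le>b. C i j * (LINT s|lborel. J (Suc i) j s))"
    using iJ by (simp add: Bochner_Integration.integral_sum)
  also have "\<dots> = (\<Sum>i\<le>a. of_real P * (of_nat (a choose i) * (- 1) ^ i * twist_coeff i b * w ^ (a - i) * cnj w ^ (b - i - 1)))"
  proof (rule sum.cong[OF refl])
    fix i
    \<comment> \<open>The extra factor \<open>cis (r * s)\<close> raises the exponent to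
      \<open>Suc i\<close>, so only the terms with \<open>j > i\<close> survive.\<close>
    have "(\<Sum>j\<le>b. C i j * (LINT s|lborel. J (Suc i) j s)) =
        (\<Sum>j\<in>{i<..b}. C i j * (of_real P * (cnj w ^ (j - Suc i) / fact (j - Suc i))))"
      using integral_circle_exp[OF r, of "Suc i" _ "cnj w"]
      by (intro sum.mono_neutral_cong_right) (auto simp: J_def set_lebesgue_integral_def P_def)
    also have "\<dots> = (\<Sum>j\<in>{i<..b}. of_real P * of_nat (a choose i) * (- 1) ^ i * w ^ (a - i) * cnj w ^ (b - i - 1) *
        (of_nat (b choose j) * (- 1) ^ j / fact (j - i - 1)))"
    proof (rule sum.cong[OF refl])
      fix j assume "j \<in> {i<..b}"
      then have "b - i - 1 = (b - j) + (j - Suc i)" by auto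
      then have "cnj w ^ (b - i - 1) = cnj w ^ (b - j) * cnj w ^ (j - Suc i)" by (simp only: power_add)
      then show "C i j * (of_real P * (cnj w ^ (j - Suc i) / fact (j - Suc i))) =
          of_real P * of_nat (a choose i) * (- 1) ^ i * w ^ (a - i) * cnj w ^ (b - i - 1) *
          (of_nat (b choose j) * (- 1) ^ j / fact (j - i - 1))"
        by (simp add: C_def)
    qed
    also have "\<dots> = of_real P * (of_nat (a choose i) * (- 1) ^ i * twist_coeff i b * w ^ (a - i) * cnj w ^ (b - i - 1))"
      by (simp add: twist_coeff_def sum_distrib_left sum_distrib_right mult_ac)
    finally show "(\<Sum>j\<le>b. C i j * (LINT s|lborel. J (Suc i) j s)) =
        of_real P * (of_nat (a choose i) * (- 1) ^ i * twist_coeff i b * w ^ (a - i) * cnj w ^ (b - i - 1))" .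
  qed
  finally show ?thesis by (simp add: P_def sum_distrib_left)
qed

text \<open>A single term of the exponential series bounds \<open>t\<close> to the power
  \<open>2 * n\<close>, and \<open>\<bar>t\<bar> ^ n\<close> is at most 1 plus that power.\<close>

lemma power_mult_gaussian_bounded:
  fixes \<alpha> :: real
  assumes "\<alpha> > 0"
  obtains B where "\<And>t. \<bar>t\<bar> ^ n * exp (- \<alpha> * t\<^sup>2) \<le> B"
proof (rule that[of "1 + fact n / \<alpha> ^ n"])
  fix t :: real
  have "(\<alpha> * t\<^sup>2) ^ n /\<^sub>R fact n \<le> exp (\<alpha> * t\<^sup>2)"
    using sum_le_suminf[of "\<lambda>k. (\<alpha> * t\<^sup>2) ^ k /\<^sub>R fact k" "{n}"] exp_converges[of "\<alpha> * t\<^sup>2"] assms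
    by (auto simp: sums_iff)
  then have 1: "(t\<^sup>2) ^ n \<le> fact n / \<alpha> ^ n * exp (\<alpha> * t\<^sup>2)"
    using assms by (simp add: power_mult_distrib field_simps)
  have "\<bar>t\<bar> ^ n \<le> 1 + (t\<^sup>2) ^ n"
  proof (cases "\<bar>t\<bar> \<le> 1")
    case True
    then have "\<bar>t\<bar> ^ n \<le> 1" by (simp add: power_le_one)
    then show ?thesis by (smt (verit) zero_le_power zero_le_power2)
  next
    case False
    then have "\<bar>t\<bar> ^ n \<le> \<bar>t\<bar> ^ (2 * n)" by (intro power_increasing) auto
    then show ?thesis by (simp add: power_mult)
  qed
  also have "\<dots> \<le> exp (\<alpha> * t\<^sup>2) + fact n / \<alpha> ^ n * exp (\<alpha> * t\<^sup>2)"
    using 1 assms by (intro add_mono) auto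
  finally have "\<bar>t\<bar> ^ n * exp (- \<alpha> * t\<^sup>2) \<le> (1 + fact n / \<alpha> ^ n) * exp (\<alpha> * t\<^sup>2) * exp (- \<alpha> * t\<^sup>2)"
    by (intro mult_right_mono) (simp_all add: distrib_right)
  then show "\<bar>t\<bar> ^ n * exp (- \<alpha> * t\<^sup>2) \<le> 1 + fact n / \<alpha> ^ n"
    by (simp add: mult.assoc exp_minus_inverse flip: exp_add)
qed

text \<open>
  The test functions are Gaussians times polynomials; the width of the Gaussian is chosen so that
  it combines with the twist to the factor \<open>exp (cnj (w x) * cis (norm lam * s))\<close>, holomorphic in
  \<open>cis (norm lam * s)\<close>.
\<close>

lemma central_fourier_zero_parallel:
  fixes br :: "('v::euclidean_space, 'z::euclidean_space) bracket"
  assumes H: "H_type br" and lam: "lam \<noteq> 0" and \<nu>: "norm \<nu> = 1"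
    and f: "integrable lborel f"
    and xray: "AE C in quot br lam. xray br \<nu> lam f C = 0"
    and \<mu>: "\<mu> = (2 * norm lam) *\<^sub>R lam"
  shows "AE x in lborel. central_fourier f \<mu> x = 0"
proof -
  let ?r = "norm lam" and ?F = "central_fourier f \<mu>"
  have r: "?r > 0" using lam by simp
  obtain e where e: "norm e = 1" "e \<bullet> \<nu> = 0" and Je: "Jmap br lam e = ?r *\<^sub>R \<nu>"
    and J\<nu>: "Jmap br lam \<nu> = - (?r *\<^sub>R e)"
    and \<gamma>: "\<And>s. gcurve br \<nu> lam s =
      ((1 / ?r) *\<^sub>R (cos (?r * s) *\<^sub>R e + sin (?r * s) *\<^sub>R \<nu>), (s / (2 * ?r)) *\<^sub>R sgn lam)"
    by (rule gcurve_circle[OF H lam \<nu>]) blast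
  define c where "c s = fst (gcurve br \<nu> lam s)" for s
  have c: "c s = (1 / ?r) *\<^sub>R (cos (?r * s) *\<^sub>R e + sin (?r * s) *\<^sub>R \<nu>)" for s
    by (simp add: c_def \<gamma>)
  have ee: "e \<bullet> e = 1" "\<nu> \<bullet> \<nu> = 1" "\<nu> \<bullet> e = 0" using e \<nu> by (auto simp: norm_eq_1 inner_commute)
  \<comment> \<open>Complex coordinate on the plane of the circle, scaled so that the circle becomes
    the unit circle.\<close>
  define w where "w x = Complex (?r * (x \<bullet> e)) (?r * (x \<bullet> \<nu>))" for x
  define G where "G x = exp (- (?r\<^sup>2 / 2) * (norm x)\<^sup>2)" for x :: 'v
  have cw: "continuous_on UNIV w"
    unfolding w_def Complex_eq by (intro continuous_intros)
  have cG: "continuous_on UNIV G" unfolding G_def by (intro continuous_intros)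
  have wc: "w (x - c s) = w x - cis (?r * s)" for x s
    using r by (simp add: w_def c complex_eq_iff inner_simps ee e(2) algebra_simps)
  \<comment> \<open>The cross term of the Gaussian contributes the real part of
    \<open>cnj (w x) * cis (?r * s)\<close> and the twist its imaginary part. The constant
    \<open>exp (- 1 / 2)\<close> comes from the squared radius
    \<open>1 / ?r\<^sup>2\<close>.\<close>
  have Gc: "of_real (G (x - c s)) * cis (of_int 1 * ?r * s + \<mu> \<bullet> hbr br x (c s) / 2) =
      of_real (exp (- 1 / 2) * G x) * (exp (cnj (w x) * cis (?r * s)) * cis (?r * s))" for x s
  proof -
    have cc: "c s \<bullet> c s = 1 / ?r\<^sup>2"
    proof -
      have "(cos (?r * s) *\<^sub>R e + sin (?r * s) *\<^sub>R \<nu>) \<bullet> (cos (?r * s) *\<^sub>R e + sin (?r * s) *\<^sub>R \<nu>) =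
          (cos (?r * s))\<^sup>2 + (sin (?r * s))\<^sup>2"
        by (simp add: inner_simps ee e(2) power2_eq_square)
      then show ?thesis unfolding c by (simp add: power2_eq_square)
    qed
    have xc: "x \<bullet> c s = (1 / ?r) * ((x \<bullet> e) * cos (?r * s) + (x \<bullet> \<nu>) * sin (?r * s))"
      unfolding c by (simp add: inner_simps algebra_simps)
    have "(norm (x - c s))\<^sup>2 = (norm x)\<^sup>2 - 2 * (x \<bullet> c s) + 1 / ?r\<^sup>2"
      by (simp add: power2_norm_eq_inner inner_diff_left inner_diff_right inner_commute[of "c s" x] cc)
    then have "- (?r\<^sup>2 / 2) * (norm (x - c s))\<^sup>2 = - 1 / 2 + - (?r\<^sup>2 / 2) * (norm x)\<^sup>2 + ?r\<^sup>2 * (x \<bullet> c s)"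
      using r by (simp add: field_simps)
    also have "?r\<^sup>2 * (x \<bullet> c s) = Re (cnj (w x) * cis (?r * s))"
      using r by (simp add: xc w_def power2_eq_square algebra_simps)
    finally have G: "G (x - c s) = exp (- 1 / 2) * G x * exp (Re (cnj (w x) * cis (?r * s)))"
      unfolding G_def exp_add[symmetric] by simp
    have "\<mu> \<bullet> hbr br x (c s) / 2 = ?r * (Jmap br lam x \<bullet> c s)"
      by (simp add: \<mu> Jmap_inner[OF H])
    also have "Jmap br lam x \<bullet> c s = - (x \<bullet> Jmap br lam (c s))" by (rule Jmap_skew[OF H])
    also have "Jmap br lam (c s) = cos (?r * s) *\<^sub>R \<nu> - sin (?r * s) *\<^sub>R e"
      using r unfolding c
      by (simp add: linear_add[OF linear_Jmap[OF H]] linear_scale[OF linear_Jmap[OF H]] Je J\<nu> scaleR_diff_right)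
    also have "?r * - (x \<bullet> (cos (?r * s) *\<^sub>R \<nu> - sin (?r * s) *\<^sub>R e)) = Im (cnj (w x) * cis (?r * s))"
      by (simp add: w_def inner_simps algebra_simps)
    finally have i: "\<mu> \<bullet> hbr br x (c s) / 2 = Im (cnj (w x) * cis (?r * s))" .
    have j: "cis (of_int 1 * ?r * s + \<mu> \<bullet> hbr br x (c s) / 2) = cis (?r * s) * cis (Im (cnj (w x) * cis (?r * s)))"
      unfolding i cis_mult by simp
    show ?thesis
      unfolding G j exp_eq_polar[of "cnj (w x) * cis (?r * s)"] by simp
  qed
  have wn: "norm (w x) \<le> 2 * ?r * norm x" for x
  proof -
    have "norm (w x) \<le> \<bar>?r * (x \<bullet> e)\<bar> + \<bar>?r * (x \<bullet> \<nu>)\<bar>" using cmod_le[of "w x"] by (simp add: w_def)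
    also have "\<dots> = ?r * \<bar>x \<bullet> e\<bar> + ?r * \<bar>x \<bullet> \<nu>\<bar>" by (simp add: abs_mult)
    also have "\<dots> \<le> ?r * norm x + ?r * norm x"
      using Cauchy_Schwarz_ineq2[of x e] Cauchy_Schwarz_ineq2[of x \<nu>] e \<nu>
      by (intro add_mono mult_left_mono) auto
    finally show ?thesis by (simp add: mult_ac)
  qed
  have zero: "(LINT x|lborel. ?F x * of_real (G x * (\<zeta> \<bullet> x) ^ n)) = 0" for \<zeta> n
  proof -
    \<comment> \<open>\<open>\<xi>\<close> is the part of \<open>\<zeta>\<close> orthogonal to the
      plane, so \<open>\<xi> \<bullet> x\<close> is unchanged by translation along the circle;
      \<open>\<alpha>\<close> below writes the rest in terms of \<open>w\<close> and its
      conjugate.\<close>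
    define \<xi> where "\<xi> = \<zeta> - (\<zeta> \<bullet> e) *\<^sub>R e - (\<zeta> \<bullet> \<nu>) *\<^sub>R \<nu>"
    have \<xi>: "\<xi> \<bullet> e = 0" "\<xi> \<bullet> \<nu> = 0"
      by (simp_all add: \<xi>_def inner_simps ee e(2))
    define \<alpha> where "\<alpha> = Complex ((\<zeta> \<bullet> e) / (2 * ?r)) (- (\<zeta> \<bullet> \<nu>) / (2 * ?r))"
    have \<zeta>: "complex_of_real (\<zeta> \<bullet> x) = of_real (\<xi> \<bullet> x) + \<alpha> * w x + cnj \<alpha> * cnj (w x)" for x
      using r by (simp add: complex_eq_iff \<alpha>_def w_def \<xi>_def inner_simps inner_commute field_simps)
    define \<phi> where "\<phi> n k a b x = of_real (G x * (\<xi> \<bullet> x) ^ k * (\<zeta> \<bullet> x) ^ n) * w x ^ a * cnj (w x) ^ b" for n k a b x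
    have c\<phi>: "continuous_on UNIV (\<phi> n k a b)" for n k a b
      unfolding \<phi>_def by (intro continuous_intros cG cw)
    then have m\<phi>[measurable]: "\<phi> n k a b \<in> borel_measurable borel" for n k a b
      by (rule borel_measurable_continuous_onI)
    have b\<phi>: "\<exists>B. \<forall>x. norm (\<phi> n k a b x) \<le> B" for n k a b
    proof -
      obtain B where B: "\<And>t. \<bar>t\<bar> ^ (k + n + (a + b)) * exp (- (?r\<^sup>2 / 2) * t\<^sup>2) \<le> B"
        using power_mult_gaussian_bounded[of "?r\<^sup>2 / 2" "k + n + (a + b)"] r by auto
      have "norm (\<phi> n k a b x) \<le> (norm \<xi> ^ k * norm \<zeta> ^ n * (2 * ?r) ^ (a + b)) * B" for x
      proof -
        have "norm (\<phi> n k a b x) = G x * (\<bar>\<xi> \<bullet> x\<bar> ^ k * \<bar>\<zeta> \<bullet> x\<bar> ^ n * norm (w x) ^ (a + b))"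
          by (simp add: \<phi>_def norm_mult norm_power power_abs abs_mult power_add G_def)
        also have "\<dots> \<le> G x * ((norm \<xi> * norm x) ^ k * (norm \<zeta> * norm x) ^ n * (2 * ?r * norm x) ^ (a + b))"
          by (intro mult_left_mono mult_mono power_mono Cauchy_Schwarz_ineq2 wn) (auto simp: G_def)
        also have "\<dots> = (norm \<xi> ^ k * norm \<zeta> ^ n * (2 * ?r) ^ (a + b)) * (norm x ^ (k + n + (a + b)) * G x)"
          by (simp add: power_mult_distrib power_add mult_ac)
        also have "\<dots> \<le> (norm \<xi> ^ k * norm \<zeta> ^ n * (2 * ?r) ^ (a + b)) * B"
          using B[of "norm x"] by (intro mult_left_mono) (auto simp: G_def)
        finally show ?thesis .
      qed
      then show ?thesis by blast
    qed
    have i\<phi>: "integrable lborel (\<lambda>x. ?F x * \<phi> n k a b x)" for n k a b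
    proof -
      obtain B where "\<And>x. norm (\<phi> n k a b x) \<le> B" using b\<phi>[of n k a b] by blast
      then show ?thesis by (rule central_fourier_integrable(1)[OF f m\<phi>])
    qed
    define I where "I n k a b = (LINT x|lborel. ?F x * \<phi> n k a b x)" for n k a b
    \<comment> \<open>The test function \<open>\<phi> 0 k a b\<close> yields a linear relation among
      moments, because its twisted mean is again a combination of such functions.\<close>
    have rel: "(\<Sum>i\<le>a. of_nat (a choose i) * (- 1) ^ i * twist_coeff i b * I 0 k (a - i) (b - i - 1)) = 0" for k a b
    proof -
      obtain B where B: "\<And>x. norm (\<phi> 0 k a b x) \<le> B" using b\<phi>[of 0 k a b] by blast
      define C where "C = complex_of_real (exp (- 1 / 2)) * of_real (2 * pi / ?r)"
      define S where "S x = (\<Sum>i\<le>a. of_nat (a choose i) * (- 1) ^ i * twist_coeff i b * \<phi> 0 k (a - i) (b - i - 1) x)" for x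
      have "(LINT x|lborel. ?F x * (C * S x)) = 0"
      proof (rule xray_zero_central_fourier[OF H lam \<nu> f xray _ c\<phi>[of 0 k a b] B])
        show "\<mu> \<bullet> sgn lam = 2 * ?r\<^sup>2 * of_int 1"
          using r by (simp add: \<mu> sgn_div_norm power2_norm_eq_inner[symmetric] power2_eq_square)
        show "(\<lambda>x. C * S x) \<in> borel_measurable borel" unfolding S_def by measurable
        fix x
        have "\<phi> 0 k a b (x - c s) * cis (of_int 1 * ?r * s + \<mu> \<bullet> hbr br x (c s) / 2) =
          of_real (exp (- 1 / 2) * G x * (\<xi> \<bullet> x) ^ k) * ((w x - cis (?r * s)) ^ a * cnj (w x - cis (?r * s)) ^ b *
            (exp (cnj (w x) * cis (?r * s)) * cis (?r * s)))" for s
        proof -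
          have "\<xi> \<bullet> (x - c s) = \<xi> \<bullet> x" unfolding c by (simp add: inner_simps \<xi>)
          then have "\<phi> 0 k a b (x - c s) * cis (of_int 1 * ?r * s + \<mu> \<bullet> hbr br x (c s) / 2) =
            of_real ((\<xi> \<bullet> x) ^ k) * ((w x - cis (?r * s)) ^ a * cnj (w x - cis (?r * s)) ^ b) *
            (of_real (G (x - c s)) * cis (of_int 1 * ?r * s + \<mu> \<bullet> hbr br x (c s) / 2))"
            by (simp only: \<phi>_def wc of_real_mult power_0 of_real_1 mult_1_left mult_1_right mult_ac)
          then show ?thesis unfolding Gc by (simp only: of_real_mult mult_ac)
        qed
        then have "(LINT s:{0..<2 * pi / ?r}|lborel. \<phi> 0 k a b (x - c s) * cis (of_int 1 * ?r * s + \<mu> \<bullet> hbr br x (c s) / 2)) =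
          of_real (exp (- 1 / 2) * G x * (\<xi> \<bullet> x) ^ k) * (of_real (2 * pi / ?r) *
            (\<Sum>i\<le>a. of_nat (a choose i) * (- 1) ^ i * twist_coeff i b * w x ^ (a - i) * cnj (w x) ^ (b - i - 1)))"
          by (simp only: set_integral_mult_right integral_twisted_circle[OF r])
        also have "\<dots> = C * S x"
          unfolding S_def C_def sum_distrib_left
          by (rule sum.cong[OF refl]) (simp add: \<phi>_def)
        finally show "(LINT s:{0..<2 * pi / ?r}|lborel. \<phi> 0 k a b (x - fst (gcurve br \<nu> lam s)) *
            cis (of_int 1 * ?r * s + \<mu> \<bullet> hbr br x (fst (gcurve br \<nu> lam s)) / 2)) = C * S x"
          unfolding c_def .
      qed
      moreover have "(LINT x|lborel. ?F x * (C * S x)) =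
          C * (\<Sum>i\<le>a. of_nat (a choose i) * (- 1) ^ i * twist_coeff i b * I 0 k (a - i) (b - i - 1))"
      proof -
        have "?F x * (C * S x) = C * (\<Sum>i\<le>a. of_nat (a choose i) * (- 1) ^ i * twist_coeff i b * (?F x * \<phi> 0 k (a - i) (b - i - 1) x))" for x
          by (simp add: S_def sum_distrib_left mult_ac)
        then have "(LINT x|lborel. ?F x * (C * S x)) = (LINT x|lborel. C * (\<Sum>i\<le>a. of_nat (a choose i) * (- 1) ^ i * twist_coeff i b * (?F x * \<phi> 0 k (a - i) (b - i - 1) x)))"
          by (rule Bochner_Integration.integral_cong[OF refl])
        then show ?thesis
          using i\<phi> by (simp add: I_def Bochner_Integration.integral_sum)
      qed
      moreover have "C \<noteq> 0" using r by (simp add: C_def)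
      ultimately show ?thesis by simp
    qed
    \<comment> \<open>In the relation for \<open>a\<close> and \<open>Suc b\<close> the term
      \<open>i = 0\<close> is a nonzero multiple of \<open>I 0 k a b\<close>, and all others have a
      smaller first exponent. Hence strong induction on \<open>a\<close> with \<open>b\<close>
      arbitrary.\<close>
    have I0: "I 0 k a b = 0" for k a b
    proof (induction a arbitrary: b rule: less_induct)
      case (less a)
      have "(\<Sum>i\<in>{..a} - {0}. of_nat (a choose i) * (- 1) ^ i * twist_coeff i (Suc b) * I 0 k (a - i) (Suc b - i - 1)) = 0"
        by (intro sum.neutral ballI) (simp add: less.IH)
      then have "twist_coeff 0 (Suc b) * I 0 k a b = 0"
        using rel[of a "Suc b" k] by (subst (asm) sum.remove[of _ 0]) auto
      then show ?case using twist_coeff_nonzero[of b] by simp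
    qed
    \<comment> \<open>One factor \<open>\<zeta> \<bullet> x\<close> at a time is split into its
      orthogonal part, its \<open>w\<close> part and its conjugate part.\<close>
    have In: "I n k a b = 0" for n k a b
    proof (induction n arbitrary: k a b)
      case 0 then show ?case by (rule I0)
    next
      case (Suc n)
      have "\<phi> (Suc n) k a b x = \<phi> n (Suc k) a b x + \<alpha> * \<phi> n k (Suc a) b x + cnj \<alpha> * \<phi> n k a (Suc b) x" for x
      proof -
        have "\<phi> (Suc n) k a b x = of_real (\<zeta> \<bullet> x) * \<phi> n k a b x"
          by (simp add: \<phi>_def)
        then show ?thesis unfolding \<zeta> by (simp add: \<phi>_def algebra_simps)
      qed
      then have "?F x * \<phi> (Suc n) k a b x = ?F x * \<phi> n (Suc k) a b x + \<alpha> * (?F x * \<phi> n k (Suc a) b x)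
          + cnj \<alpha> * (?F x * \<phi> n k a (Suc b) x)" for x
        by (simp add: algebra_simps)
      then have "I (Suc n) k a b = I n (Suc k) a b + \<alpha> * I n k (Suc a) b + cnj \<alpha> * I n k a (Suc b)"
        unfolding I_def using i\<phi> by simp
      then show ?case by (simp add: Suc.IH)
    qed
    have "\<phi> n 0 0 0 x = of_real (G x * (\<zeta> \<bullet> x) ^ n)" for x by (simp add: \<phi>_def)
    then show ?thesis using In[of n 0 0 0] by (simp only: I_def)
  qed
  define h where "h x = ?F x * of_real (G x)" for x
  have G1: "0 < G x" "G x \<le> 1" for x by (simp_all add: G_def)
  have [measurable]: "G \<in> borel_measurable borel" using cG by (rule borel_measurable_continuous_onI)
  have h: "integrable lborel h"
    unfolding h_def using G1 by (intro central_fourier_integrable(1)[OF f, where B = 1]) (auto simp: less_imp_le)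
  have "(LINT x|lborel. h x * cis (\<xi> \<bullet> x)) = 0" for \<xi>
  proof -
    have "(LINT x|lborel. h x * cis (- ((- 1) * (\<xi> \<bullet> x)))) = 0"
    proof (rule moments_zero_imp_cis_integral_zero)
      show "h \<in> borel_measurable lborel" using h by auto
      show "(LINT x|lborel. h x * of_real (\<xi> \<bullet> x) ^ n) = 0" for n
        using zero[of \<xi> n] by (simp add: h_def mult.assoc)
      fix a :: real
      \<comment> \<open>Completing the square: \<open>D\<close> bounds the exponential weight times
        the Gaussian, so all exponential moments of \<open>h\<close> are finite and its vanishing
        moments determine it.\<close>
      define D where "D = exp ((a * norm \<xi>)\<^sup>2 / (2 * ?r\<^sup>2))"
      show "integrable lborel (\<lambda>x. exp (a * \<bar>\<xi> \<bullet> x\<bar>) * norm (h x))"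
      proof (rule Bochner_Integration.integrable_bound)
        show "integrable lborel (\<lambda>x. D * norm (?F x))"
          using integrable_central_fourier[OF f] by auto
        show "(\<lambda>x. exp (a * \<bar>\<xi> \<bullet> x\<bar>) * norm (h x)) \<in> borel_measurable lborel"
          using h by measurable
        have "exp (a * \<bar>\<xi> \<bullet> x\<bar>) * G x \<le> D" for x
        proof -
          have "a * \<bar>\<xi> \<bullet> x\<bar> \<le> \<bar>a\<bar> * (norm \<xi> * norm x)"
            by (rule mult_mono) (auto simp: Cauchy_Schwarz_ineq2)
          moreover have "\<bar>a\<bar> * (norm \<xi> * norm x) - ?r\<^sup>2 / 2 * (norm x)\<^sup>2 \<le> (a * norm \<xi>)\<^sup>2 / (2 * ?r\<^sup>2)"
          proof -
            have "0 \<le> (?r * norm x - \<bar>a\<bar> * norm \<xi> / ?r)\<^sup>2" by simp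
            also have "\<dots> = ?r\<^sup>2 * (norm x)\<^sup>2 - 2 * (\<bar>a\<bar> * (norm \<xi> * norm x)) + (a * norm \<xi>)\<^sup>2 / ?r\<^sup>2"
              using r by (simp add: power2_diff power_mult_distrib power_divide)
            finally show ?thesis using r by (simp add: field_simps)
          qed
          ultimately have "a * \<bar>\<xi> \<bullet> x\<bar> + - (?r\<^sup>2 / 2) * (norm x)\<^sup>2 \<le> (a * norm \<xi>)\<^sup>2 / (2 * ?r\<^sup>2)" by simp
          then show ?thesis unfolding D_def G_def exp_add[symmetric] by simp
        qed
        then have "(exp (a * \<bar>\<xi> \<bullet> x\<bar>) * G x) * norm (?F x) \<le> D * norm (?F x)" for x
          by (intro mult_right_mono) auto
        then show "AE x in lborel. norm (exp (a * \<bar>\<xi> \<bullet> x\<bar>) * norm (h x)) \<le> norm (D * norm (?F x))"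
          using G1(1) by (intro AE_I2) (simp add: h_def norm_mult D_def mult_ac abs_mult less_imp_le)
      qed
    qed measurable
    then show ?thesis by simp
  qed
  from fourier_unique[OF h this] show ?thesis
    using G1(1) by (simp add: h_def less_imp_neq[symmetric])
qed

section \<open>Injectivity\<close>

lemma zero_setE:
  assumes "zero_set br f Z" "lam \<in> Z"
  obtains \<nu> where "lam \<noteq> 0" "norm \<nu> = 1" "AE C in quot br lam. xray br \<nu> lam f C = 0"
  using assms unfolding zero_set_def by (auto simp: subset_eq)

text \<open>The map taking \<open>lam\<close> to \<open>(2 * norm lam) *\<^sub>R lam\<close> covers
  the open shell \<open>U\<close> already on the given charges: \<open>norm \<mu>\<close> is twice
  the square of \<open>norm lam\<close>.\<close>

lemma zero_set_shell_imp_zero: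
  fixes br :: "('v::euclidean_space, 'z::euclidean_space) bracket"
  assumes H: "H_type br" and f: "integrable lborel f" "compact K" "central_supp f K"
    and "\<epsilon> > 0" and Z: "zero_set br f {lam. norm lam \<in> {1..1 + \<epsilon>}}"
  shows "AE g in lborel. f g = 0"
proof (rule central_fourier_unique[OF f])
  define U where "U = {\<mu> :: 'z. 2 < norm \<mu> \<and> norm \<mu> < 2 * (1 + \<epsilon>)\<^sup>2}"
  show "open U"
    unfolding U_def by (intro open_Collect_conj open_Collect_less continuous_intros)
  obtain b :: 'z where "norm b = 1" using SOME_Basis norm_Basis by blast
  then have "norm ((2 * (1 + \<epsilon>)) *\<^sub>R b) = 2 + 2 * \<epsilon>" using \<open>\<epsilon> > 0\<close> by simp
  moreover have "2 + 2 * \<epsilon> < 2 * (1 + \<epsilon>)\<^sup>2"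
    using \<open>\<epsilon> > 0\<close> by (simp add: power2_eq_square algebra_simps add_pos_pos)
  ultimately have "(2 * (1 + \<epsilon>)) *\<^sub>R b \<in> U" using \<open>\<epsilon> > 0\<close> by (simp add: U_def)
  then show "U \<noteq> {}" by blast
  fix \<mu> assume \<mu>: "\<mu> \<in> U"
  define lam where "lam = (1 / sqrt (2 * norm \<mu>)) *\<^sub>R \<mu>"
  have "2 < norm \<mu>" using \<mu> by (simp add: U_def)
  then have p: "norm \<mu> > 0" by linarith
  have "norm lam = norm \<mu> / sqrt (2 * norm \<mu>)" by (simp add: lam_def)
  then have nl: "2 * norm lam = sqrt (2 * norm \<mu>)"
    using p real_div_sqrt[of "2 * norm \<mu>"] by simp
  have n2: "(norm lam)\<^sup>2 = norm \<mu> / 2"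
  proof -
    have "(2 * norm lam)\<^sup>2 = 2 * norm \<mu>" unfolding nl using p by simp
    then show ?thesis by (simp add: power_mult_distrib)
  qed
  have "1\<^sup>2 \<le> (norm lam)\<^sup>2" "(norm lam)\<^sup>2 \<le> (1 + \<epsilon>)\<^sup>2"
    using \<mu> unfolding n2 U_def by auto
  then have "1 \<le> norm lam" "norm lam \<le> 1 + \<epsilon>"
    using \<open>\<epsilon> > 0\<close> by (auto intro: power2_le_imp_le)
  then have "lam \<in> {lam. norm lam \<in> {1..1 + \<epsilon>}}" by simp
  then obtain \<nu> where \<nu>: "lam \<noteq> 0" "norm \<nu> = 1" "AE C in quot br lam. xray br \<nu> lam f C = 0"
    by (rule zero_setE[OF Z])
  have "\<mu> = (2 * norm lam) *\<^sub>R lam"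
    unfolding nl using p by (simp add: lam_def)
  then show "AE x in lborel. central_fourier f \<mu> x = 0"
    by (rule central_fourier_zero_parallel[OF H \<nu>(1,2) f(1) \<nu>(3)])
qed

lemma zero_set_connected_imp_zero:
  fixes br :: "('v::euclidean_space, 'z::euclidean_space) bracket"
  assumes H: "H_type br" and f: "integrable lborel f" "compact K" "central_supp f K"
    and Z: "zero_set br f Z" and "connected C" "C \<subseteq> Z"
    and l: "l1 \<in> C" "l2 \<in> C" "l1 \<noteq> l2" "norm l1 = 1" "norm l2 = 1"
  shows "AE g in lborel. f g = 0"
proof (rule central_fourier_unique[OF f])
  define U where "U = {\<mu>. \<mu> \<bullet> l2 < 0 \<and> 0 < \<mu> \<bullet> l1}"
  show "open U"
    unfolding U_def by (intro open_Collect_conj open_Collect_less continuous_intros)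
  \<comment> \<open>Distinct unit vectors have inner product below 1, so \<open>l1 - l2\<close> is a
    witness that \<open>U\<close> is nonempty.\<close>
  have "0 < (norm (l1 - l2))\<^sup>2" using l(3) by simp
  then have "l1 \<bullet> l2 < 1"
    using l(4,5) by (simp add: power2_norm_eq_inner inner_simps norm_eq_1 inner_commute)
  then have "l1 - l2 \<in> U" using l(4,5) by (simp add: U_def inner_simps norm_eq_1 inner_commute)
  then show "U \<noteq> {}" by blast
  fix \<mu> assume "\<mu> \<in> U"
  then have "\<mu> \<bullet> l2 \<le> 0" "0 \<le> \<mu> \<bullet> l1" by (simp_all add: U_def)
  then obtain lam where lam: "lam \<in> C" "\<mu> \<bullet> lam = 0"
    using connected_ivt_hyperplane[OF \<open>connected C\<close> l(2,1)] by blast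
  then obtain \<nu> where "lam \<noteq> 0" "norm \<nu> = 1" "AE C in quot br lam. xray br \<nu> lam f C = 0"
    using zero_setE[OF Z] \<open>C \<subseteq> Z\<close> by blast
  then show "AE x in lborel. central_fourier f \<mu> x = 0"
    using central_fourier_zero_orthogonal[OF H _ _ f(1) _ lam(2)] by blast
qed

lemma zero_set_not_in_hyperplane_imp_zero:
  fixes br :: "('v::euclidean_space, 'z::euclidean_space) bracket"
  assumes "H_type br" "integrable lborel f" "compact K" "central_supp f K"
    and "zero_set br f Z" "connected Z" and Z: "Z \<subseteq> sphere 0 1"
    and hyp: "\<not> (\<exists>a b. a \<noteq> 0 \<and> Z \<subseteq> {lam. a \<bullet> lam = b})"
  shows "AE g in lborel. f g = 0"
proof -
  \<comment> \<open>Any nonzero normal \<open>b\<close> serves: the empty set and every singleton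
    lie in a hyperplane with that normal, so \<open>Z\<close> has two distinct points.\<close>
  obtain b :: 'z where b: "b \<noteq> 0" using nonzero_Basis SOME_Basis by blast
  then obtain l1 where l1: "l1 \<in> Z" using hyp by blast
  obtain l2 where l2: "l2 \<in> Z" "l2 \<noteq> l1"
    using hyp b by blast
  have "norm l1 = 1" "norm l2 = 1" using Z l1 l2 by (auto simp: subset_eq)
  then show ?thesis
    using zero_set_connected_imp_zero[OF assms(1-6) subset_refl l1 l2(1) l2(2)[symmetric]] by blast
qed

lemma exists_unit_orthogonal:
  fixes x :: "'a::euclidean_space"
  assumes "DIM('a) > 1"
  obtains y where "norm y = 1" "x \<bullet> y = 0"
proof -
  have "dim {x} < DIM('a)"
    using assms dim_le_card'[of "{x}"] by simp
  then have "span {x} \<noteq> UNIV" using dim_eq_full[of "{x}"] by auto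
  then obtain a where a: "a \<noteq> 0" "\<And>y. y \<in> span {x} \<Longrightarrow> a \<bullet> y = 0"
    using span_not_UNIV_orthogonal by blast
  then have "a \<bullet> x = 0" by (simp add: span_base)
  then show ?thesis using a(1) by (intro that[of "sgn a"]) (simp_all add: norm_sgn sgn_div_norm inner_commute)
qed

text \<open>A connected arc with two distinct endpoints inside the cap is enough. It is the radial
  projection of the segment from \<open>lam0\<close> to \<open>lam0 + h *\<^sub>R y\<close> with
  \<open>y\<close> a unit vector orthogonal to \<open>lam0\<close>.\<close>

lemma zero_set_cap_imp_zero:
  fixes br :: "('v::euclidean_space, 'z::euclidean_space) bracket"
  assumes H: "H_type br" and f: "integrable lborel f" "compact K" "central_supp f K"
    and dim: "DIM('z) > 1" and lam0: "lam0 \<in> sphere 0 1" and h: "0 < h"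
    and Z: "zero_set br f (cap lam0 h)"
  shows "AE g in lborel. f g = 0"
proof -
  obtain y where y: "norm y = 1" "lam0 \<bullet> y = 0" by (rule exists_unit_orthogonal[OF dim])
  have l0: "norm lam0 = 1" using lam0 by simp
  define p where "p t = lam0 + (t * h) *\<^sub>R y" for t :: real
  have i: "p t \<bullet> lam0 = 1" "p t \<bullet> y = t * h" for t
    using y l0 by (simp_all add: p_def inner_simps norm_eq_1 inner_commute)
  have p0: "p t \<noteq> 0" for t
  proof
    assume "p t = 0"
    then show False using i(1)[of t] by simp
  qed
  define C where "C = (\<lambda>t. sgn (p t)) ` {0..1}"
  show ?thesis
  proof (rule zero_set_connected_imp_zero[OF H f Z])
    have "continuous_on {0..1} p" unfolding p_def by (intro continuous_intros)
    then have "continuous_on {0..1} (\<lambda>t. sgn (p t))"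
      using p0 by (auto simp: sgn_div_norm intro!: continuous_intros)
    then show "connected C" unfolding C_def by (rule connected_continuous_image) simp
    show "C \<subseteq> cap lam0 h"
      unfolding C_def
    proof (rule image_subsetI)
      fix t :: real assume t: "t \<in> {0..1}"
      have "norm (p t) \<le> norm lam0 + norm ((t * h) *\<^sub>R y)" unfolding p_def by (rule norm_triangle_ineq)
      also have "\<dots> \<le> 1 + h" using t h y l0 by (simp add: abs_mult mult_le_cancel_right1)
      finally have n: "norm (p t) \<le> 1 + h" .
      \<comment> \<open>Since \<open>p t \<bullet> lam0 = 1\<close>, the height of the projected
        point is \<open>1 / norm (p t)\<close>, hence at least \<open>1 / (1 + h)\<close>, which is
        at least \<open>1 - h\<close>.\<close>
      have "(1 - h) * (1 + h) \<le> 1" by (simp add: algebra_simps)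
      then have "1 - h \<le> 1 / (1 + h)" using h by (simp add: pos_le_divide_eq)
      also have "\<dots> \<le> 1 / norm (p t)" using n p0[of t] by (intro divide_left_mono) (use h p0[of t] in auto)
      also have "\<dots> = sgn (p t) \<bullet> lam0" by (simp add: sgn_div_norm i inverse_eq_divide)
      finally show "sgn (p t) \<in> cap lam0 h" using p0 by (simp add: cap_def norm_sgn)
    qed
    show "sgn (p 0) \<in> C" "sgn (p 1) \<in> C" by (auto simp: C_def)
    show "norm (sgn (p 0)) = 1" "norm (sgn (p 1)) = 1" using p0 by (simp_all add: norm_sgn)
    \<comment> \<open>The inner product with \<open>y\<close> tells the two endpoints of the arc
      apart.\<close>
    have "sgn (p 0) \<bullet> y = 0" "sgn (p 1) \<bullet> y \<noteq> 0"
      using p0 h by (simp_all add: sgn_div_norm i)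
    then show "sgn (p 0) \<noteq> sgn (p 1)" by auto
  qed
qed

theorem corollary2p14:
  fixes br :: "('v::euclidean_space, 'z::euclidean_space) bracket"
  assumes "H_type br"
  shows
    "(\<forall>(f :: 'v \<times> 'z \<Rightarrow> complex) K Z.
        integrable lborel f \<and> compact K \<and> central_supp f K \<and> zero_set br f Z \<and>
        ((DIM('z) = 1 \<and> (\<exists>\<epsilon>>0. Z = {lam. norm lam \<in> {1..1 + \<epsilon>}})) \<or>
         (DIM('z) > 1 \<and> Z \<subseteq> sphere 0 1 \<and> compact Z \<and> connected Z \<and>
            \<not> (\<exists>a b. a \<noteq> 0 \<and> Z \<subseteq> {lam. a \<bullet> lam = b})))
        \<longrightarrow> (AE g in lborel. f g = 0)) \<and>
     (DIM('z) > 1 \<longrightarrow>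
        (\<forall>lam0 h. lam0 \<in> sphere 0 1 \<and> 0 < h \<and> h \<le> 1 \<longrightarrow>
          (\<forall>(f :: 'v \<times> 'z \<Rightarrow> complex) K.
             integrable lborel f \<and> compact K \<and> central_supp f K \<and> zero_set br f (cap lam0 h)
             \<longrightarrow> (AE g in lborel. f g = 0))))"
proof (intro conjI allI impI)
  fix f :: "'v \<times> 'z \<Rightarrow> complex" and K Z
  assume "integrable lborel f \<and> compact K \<and> central_supp f K \<and> zero_set br f Z \<and>
        ((DIM('z) = 1 \<and> (\<exists>\<epsilon>>0. Z = {lam. norm lam \<in> {1..1 + \<epsilon>}})) \<or>
         (DIM('z) > 1 \<and> Z \<subseteq> sphere 0 1 \<and> compact Z \<and> connected Z \<and>
            \<not> (\<exists>a b. a \<noteq> 0 \<and> Z \<subseteq> {lam. a \<bullet> lam = b})))"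
  then show "AE g in lborel. f g = 0"
    using zero_set_shell_imp_zero[OF assms, of f K] zero_set_not_in_hyperplane_imp_zero[OF assms, of f K Z]
    by blast
next
  fix lam0 h K and f :: "'v \<times> 'z \<Rightarrow> complex"
  assume "DIM('z) > 1" "lam0 \<in> sphere 0 1 \<and> 0 < h \<and> h \<le> 1"
    "integrable lborel f \<and> compact K \<and> central_supp f K \<and> zero_set br f (cap lam0 h)"
  then show "AE g in lborel. f g = 0"
    using zero_set_cap_imp_zero[OF assms, of f K lam0 h] by blast
qed

end
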